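(* The M2-brane with a boundary gives rise to a ten-dimensional corner in the twelve-dimensional theory, provided an eight-dimensional zero bordism is used for the transverse space.
   Context: This is a physics-style statement; its terms are used as follows. M-theory is considered on a Spin eleven-manifold $Y^{11}=X^3\times M^8$, a product of two Spin manifolds, where $X^3$ is a three-manifold with boundary $\partial X^3=\Sigma_g$ a Riemann surface, and $M^8$ is a closed eight-manifold (the transverse space). An M2-brane with boundary wraps $X^3$, its boundary being identified with $\partial X^3$. The twelve-dimensional theory is the theory on a bounding manifold $Z^{12}$ obtained by making $M^8$ into the boundary of a nine-manifold $N^9$, $\partial N^9=M^8$, so that $Z^{12}$ is the product of the two manifolds with boundary $X^3$ and $N^9$. It is then a manifold with corners of codimension two (a manifold with corners is a space locally modelled on open subsets of $[0,\infty)^n$), and the ten-dimensional corner is $\Sigma_g\times M^8$. Such an $N^9$ need not exist. The obstruction is the bordism class of $M^8$, which lies in the Spin bordism group $\Omega_8^{\mathrm{Spin}}\cong\mathbb{Z}\oplus\mathbb{Z}$, or in the oriented bordism group $\Omega_8\cong\mathbb{Z}\oplus\mathbb{Z}$ if $M^8$, $N^9$ and $Z^{12}$ are taken to be only oriented. The condition in the statement is that this class be zero. *)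

theory Defs
  imports "HOL-Analysis.Analysis" "HOL-Homology.Homology"
begin

section \<open>Smooth maps between subsets of Euclidean spaces\<close>

primrec Ck_on :: "nat \<Rightarrow> ('a::real_normed_vector \<Rightarrow> 'b::real_normed_vector) \<Rightarrow> 'a set \<Rightarrow> bool" where
  "Ck_on 0 f S \<longleftrightarrow> continuous_on S f"
| "Ck_on (Suc k) f S \<longleftrightarrow> (\<forall>x\<in>S. f differentiable (at x)) \<and>
     (\<forall>v. Ck_on k (\<lambda>x. frechet_derivative f (at x) v) S)"

text \<open>\<open>Ck_on\<close> is meant for open sets; on an arbitrary set, in particular on a relatively open
  subset of an orthant, smoothness means that the map extends locally to a smooth map.\<close>

definition smooth_on :: "'a::real_normed_vector set \<Rightarrow> ('a \<Rightarrow> 'b::real_normed_vector) \<Rightarrow> bool" where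
  "smooth_on S f \<longleftrightarrow>
     (\<forall>x\<in>S. \<exists>T g. open T \<and> x \<in> T \<and> (\<forall>k. Ck_on k g T) \<and> (\<forall>y\<in>S \<inter> T. g y = f y))"

definition orthant :: "'e::euclidean_space set" where
  "orthant = {x. \<forall>b\<in>Basis. 0 \<le> x \<bullet> b}"


section \<open>Manifolds with corners\<close>

text \<open>The dimension of the manifold is that of the model space \<open>'e\<close>. The atlas need not be maximal.\<close>

type_synonym ('p, 'e) chart = "'p set \<times> ('p \<Rightarrow> 'e)"

record ('p, 'e) manifold =
  mtop :: "'p topology"
  atlas :: "('p, 'e) chart set"

abbreviation points :: "('p, 'e) manifold \<Rightarrow> 'p set" where
  "points M \<equiv> topspace (mtop M)"

definition mdim :: "('p, 'e::euclidean_space) manifold \<Rightarrow> nat" where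
  "mdim M = DIM('e)"

definition local_rep :: "('p, 'e) chart \<Rightarrow> ('q, 'f) chart \<Rightarrow> ('p \<Rightarrow> 'q) \<Rightarrow> 'e \<Rightarrow> 'f" where
  "local_rep c d f = snd d \<circ> f \<circ> inv_into (fst c) (snd c)"

definition manifold_with_corners :: "('p, 'e::euclidean_space) manifold \<Rightarrow> bool" where
  "manifold_with_corners M \<longleftrightarrow>
     Hausdorff_space (mtop M) \<and> second_countable (mtop M) \<and>
     \<Union> (fst ` atlas M) = points M \<and>
     (\<forall>(U, \<phi>)\<in>atlas M. openin (mtop M) U \<and> openin (top_of_set orthant) (\<phi> ` U) \<and>
        homeomorphic_map (subtopology (mtop M) U) (top_of_set (\<phi> ` U)) \<phi>) \<and>
     (\<forall>c\<in>atlas M. \<forall>d\<in>atlas M. smooth_on (snd c ` (fst c \<inter> fst d)) (local_rep c d id))"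

text \<open>Number of vanishing coordinates, i.e. the codimension of the corner through a point.\<close>

definition depth :: "('p, 'e::euclidean_space) chart \<Rightarrow> 'p \<Rightarrow> nat" where
  "depth c x = card {b\<in>Basis. snd c x \<bullet> b = 0}"

definition corners :: "nat \<Rightarrow> ('p, 'e::euclidean_space) manifold \<Rightarrow> 'p set" where
  "corners k M = {x. \<exists>c\<in>atlas M. x \<in> fst c \<and> depth c x = k}"

definition boundary :: "('p, 'e::euclidean_space) manifold \<Rightarrow> 'p set" where
  "boundary M = {x. \<exists>c\<in>atlas M. x \<in> fst c \<and> depth c x \<ge> 1}"

definition manifold_with_corners_codim :: "nat \<Rightarrow> ('p, 'e::euclidean_space) manifold \<Rightarrow> bool" where
  "manifold_with_corners_codim k M \<longleftrightarrow>
     manifold_with_corners M \<and> (\<forall>c\<in>atlas M. \<forall>x\<in>fst c. depth c x \<le> k)"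

abbreviation manifold_with_boundary :: "('p, 'e::euclidean_space) manifold \<Rightarrow> bool" where
  "manifold_with_boundary \<equiv> manifold_with_corners_codim 1"

definition closed_manifold :: "('p, 'e::euclidean_space) manifold \<Rightarrow> bool" where
  "closed_manifold M \<longleftrightarrow> manifold_with_corners_codim 0 M \<and> compact_space (mtop M)"

definition prod_chart :: "('p, 'e) chart \<Rightarrow> ('q, 'f) chart \<Rightarrow> ('p \<times> 'q, 'e \<times> 'f) chart" where
  "prod_chart c d = (fst c \<times> fst d, map_prod (snd c) (snd d))"

definition prod_manifold ::
    "('p, 'e) manifold \<Rightarrow> ('q, 'f) manifold \<Rightarrow> ('p \<times> 'q, 'e \<times> 'f) manifold"  (infixr \<open>\<times>\<^sub>m\<close> 80) where
  "M \<times>\<^sub>m N = \<lparr>mtop = prod_topology (mtop M) (mtop N),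
              atlas = {prod_chart c d | c d. c \<in> atlas M \<and> d \<in> atlas N}\<rparr>"

definition empty_manifold :: "('p, 'e) manifold" where
  "empty_manifold = \<lparr>mtop = discrete_topology {}, atlas = {}\<rparr>"


section \<open>Smooth maps and their differentials\<close>

definition smooth_map ::
    "('p, 'e::euclidean_space) manifold \<Rightarrow> ('q, 'f::euclidean_space) manifold \<Rightarrow> ('p \<Rightarrow> 'q) \<Rightarrow> bool" where
  "smooth_map M N f \<longleftrightarrow> continuous_map (mtop M) (mtop N) f \<and>
     (\<forall>c\<in>atlas M. \<forall>d\<in>atlas N. smooth_on (snd c ` (fst c \<inter> f -` fst d)) (local_rep c d f))"

text \<open>The differential in coordinates. The derivative is taken within the chart image, which is
  relatively open in the orthant, so that it is unique at boundary points as well.\<close>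

definition mderiv :: "('p, 'e::euclidean_space) chart \<Rightarrow> ('q, 'f::euclidean_space) chart \<Rightarrow>
    ('p \<Rightarrow> 'q) \<Rightarrow> 'p \<Rightarrow> 'e \<Rightarrow>\<^sub>L 'f" where
  "mderiv c d f x = Blinfun (frechet_derivative (local_rep c d f)
                       (at (snd c x) within snd c ` (fst c \<inter> f -` fst d)))"

abbreviation jac :: "('p, 'e::euclidean_space) chart \<Rightarrow> ('p, 'e) chart \<Rightarrow> 'p \<Rightarrow> 'e \<Rightarrow>\<^sub>L 'e" where
  "jac c d \<equiv> mderiv c d id"

definition diffeomorphism ::
    "('p, 'e::euclidean_space) manifold \<Rightarrow> ('q, 'f::euclidean_space) manifold \<Rightarrow> ('p \<Rightarrow> 'q) \<Rightarrow> bool" where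
  "diffeomorphism M N f \<longleftrightarrow> homeomorphic_map (mtop M) (mtop N) f \<and>
     smooth_map M N f \<and> smooth_map N M (inv_into (points M) f)"

definition smooth_embedding ::
    "('p, 'e::euclidean_space) manifold \<Rightarrow> ('q, 'f::euclidean_space) manifold \<Rightarrow> ('p \<Rightarrow> 'q) \<Rightarrow> bool" where
  "smooth_embedding M N f \<longleftrightarrow> embedding_map (mtop M) (mtop N) f \<and> smooth_map M N f \<and>
     (\<forall>c\<in>atlas M. \<forall>d\<in>atlas N. \<forall>x\<in>fst c \<inter> f -` fst d. inj (blinfun_apply (mderiv c d f x)))"

text \<open>\<open>f\<close> identifies \<open>S\<close> with the boundary of \<open>X\<close>.\<close>

definition parametrizes_boundary ::
    "('p, 'e::euclidean_space) manifold \<Rightarrow> ('q, 'f::euclidean_space) manifold \<Rightarrow> ('p \<Rightarrow> 'q) \<Rightarrow> bool" where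
  "parametrizes_boundary S X f \<longleftrightarrow> smooth_embedding S X f \<and> f ` points S = boundary X"

definition wraps ::
    "('p, 'e::euclidean_space) manifold \<Rightarrow> ('q, 'f::euclidean_space) manifold \<Rightarrow> ('p \<Rightarrow> 'q) \<Rightarrow> bool" where
  "wraps B X w \<longleftrightarrow> diffeomorphism B X w \<and> w ` boundary B = boundary X"


section \<open>Riemann surfaces\<close>

text \<open>For a manifold without boundary the chart images are open subsets of the open first quadrant
  of the complex plane; this is no restriction, since every open set is covered by discs, which can
  be translated there.\<close>

definition compact_riemann_surface :: "nat \<Rightarrow> ('p, complex) manifold \<Rightarrow> bool" where
  "compact_riemann_surface g S \<longleftrightarrow> closed_manifold S \<and> points S \<noteq> {} \<and> connected_space (mtop S) \<and>
     (\<forall>c\<in>atlas S. \<forall>d\<in>atlas S. local_rep c d id holomorphic_on (snd c ` (fst c \<inter> fst d))) \<and>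
     homology_group 1 (mtop S) \<cong> free_Abelian_group {..<2 * g}"


section \<open>Orientations and Spin structures\<close>

definition GL :: "('e::euclidean_space \<Rightarrow>\<^sub>L 'e) set" where
  "GL = {A. \<exists>B. A o\<^sub>L B = id_blinfun \<and> B o\<^sub>L A = id_blinfun}"

text \<open>The subgroup of positive determinant, as the identity component.\<close>

definition GL_plus :: "('e::euclidean_space \<Rightarrow>\<^sub>L 'e) set" where
  "GL_plus = path_component_set GL id_blinfun"

definition oriented :: "('p, 'e::euclidean_space) manifold \<Rightarrow> bool" where
  "oriented M \<longleftrightarrow> (\<forall>c\<in>atlas M. \<forall>d\<in>atlas M. \<forall>x\<in>fst c \<inter> fst d. jac c d x \<in> GL_plus)"

text \<open>In dimension at least 3 the fundamental group of \<open>GL_plus\<close> has order two, and the connected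
  double cover of \<open>GL_plus\<close>, which contains the Spin group over the special orthogonal group, is the
  universal cover: the group of homotopy classes of paths in \<open>GL\<close> starting at the identity, with
  pointwise multiplication. A Spin structure is a lift of the tangent bundle to this double cover,
  i.e. a lift of the cocycle of Jacobians. Elements of the cover are given by representing paths and
  compared up to homotopy relative to the end points. \<open>continuous_lift T V A s\<close> says that \<open>s\<close>
  represents a continuous lift of the map \<open>A\<close> on the open set \<open>V\<close>: locally the classes come from
  a continuous family of paths.\<close>

definition continuous_lift ::
    "'p topology \<Rightarrow> 'p set \<Rightarrow> ('p \<Rightarrow> 'e::euclidean_space \<Rightarrow>\<^sub>L 'e) \<Rightarrow> ('p \<Rightarrow> real \<Rightarrow> 'e \<Rightarrow>\<^sub>L 'e) \<Rightarrow> bool" where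
  "continuous_lift T V A s \<longleftrightarrow>
     (\<forall>x\<in>V. \<exists>U H. openin T U \<and> x \<in> U \<and> U \<subseteq> V \<and>
        continuous_map (prod_topology (subtopology T U) (top_of_set {0..1})) (top_of_set GL)
          (\<lambda>(y, t). H y t) \<and>
        (\<forall>y\<in>U. H y 0 = id_blinfun \<and> H y 1 = A y \<and> homotopic_paths GL (H y) (s y)))"

type_synonym ('p, 'e) spin_lift = "('p, 'e) chart \<Rightarrow> ('p, 'e) chart \<Rightarrow> 'p \<Rightarrow> real \<Rightarrow> 'e \<Rightarrow>\<^sub>L 'e"

definition spin_structure :: "('p, 'e::euclidean_space) manifold \<Rightarrow> ('p, 'e) spin_lift \<Rightarrow> bool" where
  "spin_structure M s \<longleftrightarrow> 3 \<le> DIM('e) \<and> oriented M \<and>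
     (\<forall>c\<in>atlas M. \<forall>d\<in>atlas M. continuous_lift (mtop M) (fst c \<inter> fst d) (jac c d) (s c d)) \<and>
     (\<forall>c\<in>atlas M. \<forall>d\<in>atlas M. \<forall>e\<in>atlas M. \<forall>x\<in>fst c \<inter> fst d \<inter> fst e.
        homotopic_paths GL (\<lambda>t. s d e x t o\<^sub>L s c d x t) (s c e x))"

definition block_diag ::
    "('e::euclidean_space \<Rightarrow>\<^sub>L 'e) \<Rightarrow> ('f::euclidean_space \<Rightarrow>\<^sub>L 'f) \<Rightarrow> ('e \<times> 'f) \<Rightarrow>\<^sub>L ('e \<times> 'f)" where
  "block_diag A B = Blinfun (map_prod (blinfun_apply A) (blinfun_apply B))"

text \<open>\<open>s\<close> is the product of the Spin structures \<open>sM\<close> and \<open>sN\<close>.\<close>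

definition product_spin_structure :: "('p, 'e::euclidean_space) manifold \<Rightarrow> ('p, 'e) spin_lift \<Rightarrow>
    ('q, 'f::euclidean_space) manifold \<Rightarrow> ('q, 'f) spin_lift \<Rightarrow> ('p \<times> 'q, 'e \<times> 'f) spin_lift \<Rightarrow> bool" where
  "product_spin_structure M sM N sN s \<longleftrightarrow> spin_structure (M \<times>\<^sub>m N) s \<and>
     (\<forall>c\<in>atlas M. \<forall>c'\<in>atlas M. \<forall>d\<in>atlas N. \<forall>d'\<in>atlas N.
        \<forall>x\<in>fst c \<inter> fst c'. \<forall>y\<in>fst d \<inter> fst d'.
        homotopic_paths GL (s (prod_chart c d) (prod_chart c' d') (x, y))
          (\<lambda>t. block_diag (sM c c' x t) (sN d d' y t)))"


section \<open>Induced structures on the boundary\<close>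

text \<open>Let \<open>j\<close> embed \<open>M\<close>, with model space \<open>'e\<close>, into the boundary of \<open>N\<close>, with model space
  \<open>real \<times> 'e\<close>. For \<open>\<epsilon> = 1\<close> (\<open>\<epsilon> = - 1\<close>), a field \<open>\<nu>\<close> as below is a continuous outward (inward)
  pointing section of the tangent bundle of \<open>N\<close> along \<open>j\<close>, in the coordinates of each chart of \<open>N\<close>.
  The structure induced on \<open>M\<close> is the one for which the isomorphism of the sum of a trivial line
  bundle and the tangent bundle of \<open>M\<close> with the restricted tangent bundle of \<open>N\<close>, given by \<open>\<nu>\<close> and
  the differential of \<open>j\<close>, preserves orientations (lifts to the double covers). For \<open>\<epsilon> = - 1\<close> this
  makes \<open>M\<close> with the opposite structure a part of the boundary. The choice of \<open>\<nu>\<close> is irrelevant,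
  as the possible fields form a convex set.\<close>

definition normal_field ::
    "real \<Rightarrow> ('p, 'e::euclidean_space) manifold \<Rightarrow> ('q, real \<times> 'e) manifold \<Rightarrow> ('p \<Rightarrow> 'q) \<Rightarrow>
     (('q, real \<times> 'e) chart \<Rightarrow> 'p \<Rightarrow> real \<times> 'e) \<Rightarrow> bool" where
  "normal_field \<epsilon> M N j \<nu> \<longleftrightarrow>
     (\<forall>d\<in>atlas N. continuous_map (subtopology (mtop M) (j -` fst d)) euclidean (\<nu> d)) \<and>
     (\<forall>d\<in>atlas N. \<forall>d'\<in>atlas N. \<forall>x\<in>points M \<inter> j -` (fst d \<inter> fst d').
        \<nu> d' x = jac d d' (j x) (\<nu> d x)) \<and>
     (\<forall>d\<in>atlas N. \<forall>x\<in>points M \<inter> j -` fst d. \<forall>b\<in>Basis.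
        snd d (j x) \<bullet> b = 0 \<longrightarrow> \<epsilon> * (\<nu> d x \<bullet> b) < 0)"

definition boundary_frame :: "(('q, real \<times> 'e) chart \<Rightarrow> 'p \<Rightarrow> real \<times> 'e) \<Rightarrow> ('p \<Rightarrow> 'q) \<Rightarrow>
    ('p, 'e::euclidean_space) chart \<Rightarrow> ('q, real \<times> 'e) chart \<Rightarrow> 'p \<Rightarrow> (real \<times> 'e) \<Rightarrow>\<^sub>L (real \<times> 'e)" where
  "boundary_frame \<nu> j c d x = Blinfun (\<lambda>(a, v). a *\<^sub>R \<nu> d x + mderiv c d j x v)"

definition oriented_boundary_embedding ::
    "real \<Rightarrow> ('p, 'e::euclidean_space) manifold \<Rightarrow> ('q, real \<times> 'e) manifold \<Rightarrow> ('p \<Rightarrow> 'q) \<Rightarrow> bool" where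
  "oriented_boundary_embedding \<epsilon> M N j \<longleftrightarrow> smooth_embedding M N j \<and> j ` points M \<subseteq> boundary N \<and>
     (\<exists>\<nu>. normal_field \<epsilon> M N j \<nu> \<and>
        (\<forall>c\<in>atlas M. \<forall>d\<in>atlas N. \<forall>x\<in>fst c \<inter> j -` fst d. boundary_frame \<nu> j c d x \<in> GL_plus))"

definition spin_boundary_embedding ::
    "real \<Rightarrow> ('p, 'e::euclidean_space) manifold \<Rightarrow> ('p, 'e) spin_lift \<Rightarrow>
     ('q, real \<times> 'e) manifold \<Rightarrow> ('q, real \<times> 'e) spin_lift \<Rightarrow> ('p \<Rightarrow> 'q) \<Rightarrow> bool" where
  "spin_boundary_embedding \<epsilon> M sM N sN j \<longleftrightarrow> smooth_embedding M N j \<and> j ` points M \<subseteq> boundary N \<and>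
     (\<exists>\<nu> l. normal_field \<epsilon> M N j \<nu> \<and>
        (\<forall>c\<in>atlas M. \<forall>d\<in>atlas N.
           continuous_lift (mtop M) (fst c \<inter> j -` fst d) (boundary_frame \<nu> j c d) (l c d)) \<and>
        (\<forall>c\<in>atlas M. \<forall>c'\<in>atlas M. \<forall>d\<in>atlas N. \<forall>d'\<in>atlas N.
           \<forall>x\<in>fst c \<inter> fst c' \<inter> j -` (fst d \<inter> fst d').
           homotopic_paths GL
             (\<lambda>t. sN d d' (j x) t o\<^sub>L l c' d x t o\<^sub>L block_diag id_blinfun (sM c c' x t)) (l c d' x)))"


section \<open>Bordism\<close>

text \<open>Bordism groups need a fixed set of points to draw representatives from. A second countable
  manifold has at most continuum many points, so up to isomorphism it lives on a subset of \<open>real\<close>,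
  with a topology that has nothing to do with that of the reals. The zero class is that of the
  empty manifold.\<close>

definition oriented_bordant ::
    "('p, 'e::euclidean_space) manifold \<Rightarrow> ('q, 'e) manifold \<Rightarrow> bool" where
  "oriented_bordant M M' \<longleftrightarrow>
     (\<exists>(W :: (real, real \<times> 'e) manifold) j j'.
        manifold_with_boundary W \<and> compact_space (mtop W) \<and> oriented W \<and>
        oriented_boundary_embedding 1 M W j \<and> oriented_boundary_embedding (- 1) M' W j' \<and>
        j ` points M \<inter> j' ` points M' = {} \<and> j ` points M \<union> j' ` points M' = boundary W)"

definition spin_bordant :: "('p, 'e::euclidean_space) manifold \<Rightarrow> ('p, 'e) spin_lift \<Rightarrow>
    ('q, 'e) manifold \<Rightarrow> ('q, 'e) spin_lift \<Rightarrow> bool" where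
  "spin_bordant M s M' s' \<longleftrightarrow>
     (\<exists>(W :: (real, real \<times> 'e) manifold) sW j j'.
        manifold_with_boundary W \<and> compact_space (mtop W) \<and> spin_structure W sW \<and>
        spin_boundary_embedding 1 M s W sW j \<and> spin_boundary_embedding (- 1) M' s' W sW j' \<and>
        j ` points M \<inter> j' ` points M' = {} \<and> j ` points M \<union> j' ` points M' = boundary W)"

definition oriented_bordism_class ::
    "('p, 'e::euclidean_space) manifold \<Rightarrow> (real, 'e) manifold set" where
  "oriented_bordism_class M = {M'. closed_manifold M' \<and> oriented M' \<and> oriented_bordant M M'}"

definition spin_bordism_class :: "('p, 'e::euclidean_space) manifold \<Rightarrow> ('p, 'e) spin_lift \<Rightarrow>
    ((real, 'e) manifold \<times> (real, 'e) spin_lift) set" where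
  "spin_bordism_class M s =
     {(M', s'). closed_manifold M' \<and> spin_structure M' s' \<and> spin_bordant M s M' s'}"

definition oriented_bordism_zero :: "(real, 'e::euclidean_space) manifold set" where
  "oriented_bordism_zero = oriented_bordism_class (empty_manifold :: (real, 'e) manifold)"

text \<open>The empty manifold has no charts, so the choice of lift does not matter.\<close>

definition spin_bordism_zero :: "((real, 'e::euclidean_space) manifold \<times> (real, 'e) spin_lift) set" where
  "spin_bordism_zero =
     spin_bordism_class (empty_manifold :: (real, 'e) manifold) (\<lambda>_ _ _ _. id_blinfun)"


section \<open>The ten-dimensional corner\<close>

text \<open>\<open>X\<close> has boundary \<open>S\<close>, identified by \<open>i\<close>; the M2-brane world-volume \<open>B\<close> wraps \<open>X\<close> by \<open>w\<close>;
  and \<open>N\<close> has boundary \<open>M\<close>, identified by \<open>j\<close>. The twelve-manifold \<open>X \<times>\<^sub>m N\<close> has corners of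
  codimension two; its boundary consists of two faces, one of them the space-time \<open>X \<times>\<^sub>m M\<close>, and
  they meet in the corner, which is the ten-manifold \<open>S \<times>\<^sub>m M\<close> and also the product of the
  boundary of the brane with \<open>M\<close>.\<close>

definition ten_dimensional_corner ::
    "('x, real ^ 3) manifold \<Rightarrow> ('s, complex) manifold \<Rightarrow> ('s \<Rightarrow> 'x) \<Rightarrow>
     ('b, real ^ 3) manifold \<Rightarrow> ('b \<Rightarrow> 'x) \<Rightarrow>
     ('m, real ^ 8) manifold \<Rightarrow> ('n, real \<times> (real ^ 8)) manifold \<Rightarrow> ('m \<Rightarrow> 'n) \<Rightarrow> bool" where
  "ten_dimensional_corner X S i B w M N j \<longleftrightarrow>
     manifold_with_corners_codim 2 (X \<times>\<^sub>m N) \<and> mdim (X \<times>\<^sub>m N) = 12 \<and>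
     boundary (X \<times>\<^sub>m N) = boundary X \<times> points N \<union> points X \<times> boundary N \<and>
     smooth_embedding (X \<times>\<^sub>m M) (X \<times>\<^sub>m N) (map_prod id j) \<and>
     map_prod id j ` points (X \<times>\<^sub>m M) = points X \<times> boundary N \<and>
     corners 2 (X \<times>\<^sub>m N) = (boundary X \<times> points N) \<inter> (points X \<times> boundary N) \<and>
     closed_manifold (S \<times>\<^sub>m M) \<and> mdim (S \<times>\<^sub>m M) = 10 \<and>
     smooth_embedding (S \<times>\<^sub>m M) (X \<times>\<^sub>m N) (map_prod i j) \<and>
     map_prod i j ` points (S \<times>\<^sub>m M) = corners 2 (X \<times>\<^sub>m N) \<and>
     map_prod w j ` (boundary B \<times> points M) = corners 2 (X \<times>\<^sub>m N)"

end

(*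
  Membership of the empty manifold in the zero class turns the equality of bordism classes into a
  bordism N from M to the empty manifold, so that M is the whole boundary of N. Depths add up in
  the product of X and N; hence its corners of codimension two are the product of the two
  boundaries, and Sigma x M is embedded onto them by the product of the two identifications.
  In product charts the differential of a product map is block diagonal. Block sums preserve the
  identity component of GL and homotopies of paths in GL, so orientations and lifts to the double
  covers can be multiplied.
*)

theory Submission
  imports Defs
begin

section \<open>Smoothness of products\<close>

text \<open>The obstacle is that differentials are chosen, not given: \<open>mderiv\<close> picks
  some derivative of a local representative within a chart image, which may contain boundary and
  corner points. Its block form on product charts therefore rests on uniqueness of such derivatives.
  The product of two orthants is an orthant, the domains are relatively open in it, and from each of
  its points one can step in the positive direction of every axis; this is enough for uniqueness.
  Applied to identities this yields the Jacobians of the product, applied to the identifications of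
  boundaries it yields the immersion conditions. A second difficulty is one of encoding: a Spin lift
  is a function of charts, and a chart of the product does not carry its two factors along, so they
  have to be recovered from its domain and its coordinate map.\<close>

lemma Ck_on_cong:
  assumes "Ck_on k f S" "open S" "\<And>x. x \<in> S \<Longrightarrow> f x = g x"
  shows "Ck_on k g S"
  using assms(1,3)
proof (induction k arbitrary: f g)
  case 0
  then show ?case by (simp cong: continuous_on_cong)
next
  case (Suc k)
  have f: "f differentiable (at x)" if "x \<in> S" for x
    using Suc.prems that by simp
  \<comment> \<open>\<open>Ck_on\<close> takes derivatives in the full space, so agreement on
    \<open>S\<close> passes to derivatives only because \<open>S\<close> is open.\<close>
  have eq: "frechet_derivative f (at x) = frechet_derivative g (at x)" if "x \<in> S" for x
    by (rule frechet_derivative_transform_within_open[OF f[OF that] \<open>open S\<close> that Suc.prems(2)])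
  have "Ck_on k (\<lambda>x. frechet_derivative g (at x) v) S" for v
    by (rule Suc.IH[where f = "\<lambda>x. frechet_derivative f (at x) v"]) (use Suc.prems eq in auto)
  moreover have "g differentiable (at x)" if x: "x \<in> S" for x
  proof -
    obtain f' where "(f has_derivative f') (at x)"
      using f[OF x] by (auto simp: differentiable_def)
    then have "(g has_derivative f') (at x)"
      by (rule has_derivative_transform_within_open[OF _ \<open>open S\<close> x]) (rule Suc.prems(2))
    then show ?thesis
      by (auto simp: differentiable_def)
  qed
  ultimately show ?case by simp
qed

lemma has_derivative_map_prod:
  assumes f: "(f has_derivative f') (at x within S)" and g: "(g has_derivative g') (at y within T)"
  shows "(map_prod f g has_derivative map_prod f' g') (at (x, y) within S \<times> T)"
proof -
  have fst: "(fst has_derivative fst) (at (x, y) within S \<times> T)"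
    and snd: "(snd has_derivative snd) (at (x, y) within S \<times> T)"
    by (auto intro!: bounded_linear_imp_has_derivative bounded_linear_fst bounded_linear_snd)
  have "((\<lambda>p. f (fst p)) has_derivative (\<lambda>p. f' (fst p))) (at (x, y) within S \<times> T)"
    by (rule has_derivative_in_compose[OF fst]) (simp add: has_derivative_subset[OF f] image_subset_iff)
  moreover have "((\<lambda>p. g (snd p)) has_derivative (\<lambda>p. g' (snd p))) (at (x, y) within S \<times> T)"
    by (rule has_derivative_in_compose[OF snd]) (simp add: has_derivative_subset[OF g] image_subset_iff)
  ultimately have "((\<lambda>p. (f (fst p), g (snd p))) has_derivative (\<lambda>p. (f' (fst p), g' (snd p))))
      (at (x, y) within S \<times> T)"
    by (rule has_derivative_Pair)
  then show ?thesis
    by (simp add: map_prod_def case_prod_unfold)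
qed

text \<open>The induction closes because the derivative of a product map in a fixed direction
  \<open>v\<close> is again a product map, made of the derivatives of the factors in the directions
  \<open>fst v\<close> and \<open>snd v\<close>.\<close>

lemma Ck_on_map_prod:
  assumes "Ck_on k f S" "Ck_on k g T" "open S" "open T"
  shows "Ck_on k (map_prod f g) (S \<times> T)"
  using assms(1,2)
proof (induction k arbitrary: f g)
  case 0
  then show ?case
    by (auto simp: map_prod_def case_prod_unfold
        intro!: continuous_intros intro: continuous_on_compose2[of S f] continuous_on_compose2[of T g])
next
  case (Suc k)
  have D: "(map_prod f g has_derivative
      map_prod (frechet_derivative f (at x)) (frechet_derivative g (at y))) (at (x, y))"
    if "x \<in> S" "y \<in> T" for x y
    using has_derivative_map_prod[of f _ x UNIV g _ y UNIV] Suc.prems that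
    by (simp add: frechet_derivative_works[symmetric])
  have "Ck_on k (\<lambda>p. frechet_derivative (map_prod f g) (at p) v) (S \<times> T)" for v
  proof (rule Ck_on_cong)
    show "Ck_on k (map_prod (\<lambda>x. frechet_derivative f (at x) (fst v))
        (\<lambda>y. frechet_derivative g (at y) (snd v))) (S \<times> T)"
      using Suc by simp
    fix p assume "p \<in> S \<times> T"
    then show "map_prod (\<lambda>x. frechet_derivative f (at x) (fst v))
        (\<lambda>y. frechet_derivative g (at y) (snd v)) p = frechet_derivative (map_prod f g) (at p) v"
      by (cases p; cases v) (simp add: frechet_derivative_at[OF D, symmetric])
  qed (use assms in \<open>simp add: open_Times\<close>)
  moreover have "map_prod f g differentiable (at p)" if "p \<in> S \<times> T" for p
    using that D unfolding differentiable_def by (cases p) blast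
  ultimately show ?case by simp
qed

lemma smooth_on_cong:
  assumes "smooth_on S f" "\<And>x. x \<in> S \<Longrightarrow> f x = g x"
  shows "smooth_on S g"
  using assms unfolding smooth_on_def by (metis IntD1)

lemma smooth_on_map_prod:
  assumes "smooth_on S f" "smooth_on T g"
  shows "smooth_on (S \<times> T) (map_prod f g)"
  unfolding smooth_on_def
proof safe
  fix x y assume "x \<in> S" "y \<in> T"
  then obtain U V f' g' where
    "open U" "x \<in> U" "\<forall>k. Ck_on k f' U" "\<forall>z\<in>S \<inter> U. f' z = f z" and
    "open V" "y \<in> V" "\<forall>k. Ck_on k g' V" "\<forall>z\<in>T \<inter> V. g' z = g z"
    using assms unfolding smooth_on_def by metis
  then show "\<exists>W h. open W \<and> (x, y) \<in> W \<and> (\<forall>k. Ck_on k h W) \<and> (\<forall>z\<in>S \<times> T \<inter> W. h z = map_prod f g z)"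
    by (intro exI[of _ "U \<times> V"] exI[of _ "map_prod f' g'"]) (auto intro: open_Times Ck_on_map_prod)
qed

text \<open>A local smooth extension is differentiable at \<open>x\<close>, and \<open>f\<close>
  agrees with it on the part of \<open>S\<close> near \<open>x\<close>, which is all that a
  derivative within \<open>S\<close> sees.\<close>

lemma smooth_on_imp_differentiable:
  assumes "smooth_on S f" "x \<in> S"
  shows "f differentiable (at x within S)"
proof -
  obtain T g where "open T" "x \<in> T" "Ck_on 1 g T" and eq: "\<And>y. y \<in> S \<inter> T \<Longrightarrow> g y = f y"
    using assms unfolding smooth_on_def by metis
  then obtain g' where "(g has_derivative g') (at x)"
    by (auto simp: differentiable_def)
  then have "(g has_derivative g') (at x within S \<inter> T)"
    by (rule has_derivative_at_withinI)
  then have "(f has_derivative g') (at x within S \<inter> T)"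
    by (rule has_derivative_transform[rotated 2]) (use eq assms \<open>x \<in> T\<close> in auto)
  then have "(f has_derivative g') (at x within S)"
    using at_within_nhd[OF \<open>x \<in> T\<close> \<open>open T\<close>, of "S \<inter> T" S] by auto
  then show ?thesis
    by (auto simp: differentiable_def)
qed

text \<open>This is why corners, unlike mere boundaries, are stable under products: the basis of the
  product consists of the two embedded bases, so the sign conditions separate.\<close>

lemma orthant_Times: "(orthant :: ('e::euclidean_space \<times> 'f::euclidean_space) set) = orthant \<times> orthant"
  by (auto simp: orthant_def Basis_prod_def ball_Un)

text \<open>A small step \<open>d *\<^sub>R b\<close> with positive \<open>d\<close> never leaves
  the orthant, even from a corner point. So every axis is tested by points of \<open>S\<close>
  arbitrarily close to \<open>x\<close>, and a linear map is determined by its values on the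
  axes.\<close>

lemma frechet_derivative_unique_orthant:
  fixes f :: "'e::euclidean_space \<Rightarrow> 'f::real_normed_vector"
  assumes S: "openin (top_of_set orthant) S" "x \<in> S"
    and f: "(f has_derivative f') (at x within S)" "(f has_derivative f'') (at x within S)"
  shows "f' = f''"
proof (rule frechet_derivative_unique_within[OF f])
  fix b :: 'e and e :: real
  assume b: "b \<in> Basis" and "e > 0"
  obtain r where r: "r > 0" "ball x r \<inter> orthant \<subseteq> S" and x: "x \<in> orthant"
    using S unfolding openin_contains_ball by (meson subsetD)
  define d where "d = min e r / 2"
  have d: "0 < d" "d < e" "d < r"
    using \<open>e > 0\<close> r by (auto simp: d_def)
  then have "x + d *\<^sub>R b \<in> ball x r \<inter> orthant"
    using x b by (auto simp: orthant_def dist_norm inner_add_left inner_Basis)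
  then show "\<exists>d. 0 < \<bar>d\<bar> \<and> \<bar>d\<bar> < e \<and> x + d *\<^sub>R b \<in> S"
    using d r by (intro exI[of _ d]) auto
qed

section \<open>Block sums\<close>

lemma block_diag_apply [simp]:
  "blinfun_apply (block_diag A B) v = (blinfun_apply A (fst v), blinfun_apply B (snd v))"
proof -
  have "bounded_linear (\<lambda>v. (blinfun_apply A (fst v), blinfun_apply B (snd v)))"
    by (rule bounded_linear_Pair[OF
        bounded_linear_compose[OF blinfun.bounded_linear_right bounded_linear_fst]
        bounded_linear_compose[OF blinfun.bounded_linear_right bounded_linear_snd]])
  then show ?thesis
    by (simp add: block_diag_def map_prod_def case_prod_unfold bounded_linear_Blinfun_apply)
qed

lemma block_diag_compose: "block_diag (A o\<^sub>L A') (B o\<^sub>L B') = block_diag A B o\<^sub>L block_diag A' B'"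
  by (rule blinfun_eqI) simp

lemma block_diag_id: "block_diag id_blinfun id_blinfun = id_blinfun"
  by (rule blinfun_eqI) simp

lemma block_diag_in_GL: "A \<in> GL \<Longrightarrow> B \<in> GL \<Longrightarrow> block_diag A B \<in> GL"
  unfolding GL_def mem_Collect_eq by (metis block_diag_compose block_diag_id)

text \<open>This is the source of the continuity of block sums of paths, homotopies and local
  families. The constant 2 comes from bounding the two components separately, each by
  \<open>norm p * norm v\<close>.\<close>

lemma bounded_linear_block_diag: "bounded_linear (\<lambda>(A, B). block_diag A B)"
proof (rule bounded_linear_intro[where K = 2])
  fix p q :: "('a \<Rightarrow>\<^sub>L 'a) \<times> ('b \<Rightarrow>\<^sub>L 'b)" and r :: real
  show "(case p + q of (A, B) \<Rightarrow> block_diag A B) =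
      (case p of (A, B) \<Rightarrow> block_diag A B) + (case q of (A, B) \<Rightarrow> block_diag A B)"
    by (rule blinfun_eqI)
      (simp add: case_prod_unfold blinfun.add_left)
  show "(case r *\<^sub>R p of (A, B) \<Rightarrow> block_diag A B) = r *\<^sub>R (case p of (A, B) \<Rightarrow> block_diag A B)"
    by (rule blinfun_eqI)
      (simp add: case_prod_unfold blinfun.scaleR_left)
  show "norm (case p of (A, B) \<Rightarrow> block_diag A B) \<le> norm p * 2"
  proof (rule norm_blinfun_bound)
    fix v :: "'a \<times> 'b"
    have 1: "norm (fst p) * norm (fst v) \<le> norm p * norm v"
      using norm_fst_le[of "fst p" "snd p"] norm_fst_le[of "fst v" "snd v"] by (simp add: mult_mono)
    have 2: "norm (snd p) * norm (snd v) \<le> norm p * norm v"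
      using norm_snd_le[of "snd p" "fst p"] norm_snd_le[of "snd v" "fst v"] by (simp add: mult_mono)
    have "norm (blinfun_apply (case p of (A, B) \<Rightarrow> block_diag A B) v)
        \<le> norm (fst p (fst v)) + norm (snd p (snd v))"
      by (simp add: case_prod_unfold norm_Pair_le)
    also have "\<dots> \<le> norm (fst p) * norm (fst v) + norm (snd p) * norm (snd v)"
      by (intro add_mono norm_blinfun)
    also have "\<dots> \<le> norm p * 2 * norm v"
      using 1 2 by simp
    finally show "norm (blinfun_apply (case p of (A, B) \<Rightarrow> block_diag A B) v) \<le> norm p * 2 * norm v" .
  qed simp
qed

lemma continuous_on_block_diag [continuous_intros]:
  assumes "continuous_on S f" "continuous_on S g"
  shows "continuous_on S (\<lambda>x. block_diag (f x) (g x))"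
  using bounded_linear.continuous_on[OF bounded_linear_block_diag continuous_on_Pair[OF assms]] by simp

lemma GL_plus_subset_GL: "GL_plus \<subseteq> GL"
  by (simp add: GL_plus_def path_component_subset)

text \<open>Since \<open>GL_plus\<close> is a path component, no determinant has to be computed: the
  pointwise block sum of two paths from the identity is a path in \<open>GL\<close> from the
  identity to the block sum.\<close>

lemma block_diag_in_GL_plus:
  assumes "A \<in> GL_plus" "B \<in> GL_plus"
  shows "block_diag A B \<in> GL_plus"
proof -
  obtain p q where p: "path p" "path_image p \<subseteq> GL" "pathstart p = id_blinfun" "pathfinish p = A"
    and q: "path q" "path_image q \<subseteq> GL" "pathstart q = id_blinfun" "pathfinish q = B"
    using assms by (auto simp: GL_plus_def path_component_def)
  have "path (\<lambda>t. block_diag (p t) (q t))"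
    using p q by (auto simp: path_def intro: continuous_intros)
  moreover have "path_image (\<lambda>t. block_diag (p t) (q t)) \<subseteq> GL"
    using p q by (auto simp: path_image_def intro!: block_diag_in_GL)
  ultimately show ?thesis
    using p q unfolding GL_plus_def path_component_def mem_Collect_eq
    by (intro exI[of _ "\<lambda>t. block_diag (p t) (q t)"])
      (auto simp: pathstart_def pathfinish_def block_diag_id)
qed

text \<open>Homotopies relative to the end points can be summed blockwise. Hence the block sum
  descends to homotopy classes of paths, that is, to the covers in which Spin lifts take their
  values.\<close>

lemma homotopic_paths_block_diag:
  assumes "homotopic_paths GL p p'" "homotopic_paths GL q q'"
  shows "homotopic_paths GL (\<lambda>t. block_diag (p t) (q t)) (\<lambda>t. block_diag (p' t) (q' t))"
proof -
  obtain h where h: "continuous_on ({0..1} \<times> {0..1}) h" "h \<in> ({0..1} \<times> {0..1}) \<rightarrow> GL"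
      "\<forall>x\<in>{0..1}. h (0, x) = p x" "\<forall>x\<in>{0..1}. h (1, x) = p' x"
      "\<forall>t\<in>{0..1::real}. pathstart (h \<circ> Pair t) = pathstart p \<and> pathfinish (h \<circ> Pair t) = pathfinish p"
    using assms(1) unfolding homotopic_paths by metis
  obtain k where k: "continuous_on ({0..1} \<times> {0..1}) k" "k \<in> ({0..1} \<times> {0..1}) \<rightarrow> GL"
      "\<forall>x\<in>{0..1}. k (0, x) = q x" "\<forall>x\<in>{0..1}. k (1, x) = q' x"
      "\<forall>t\<in>{0..1::real}. pathstart (k \<circ> Pair t) = pathstart q \<and> pathfinish (k \<circ> Pair t) = pathfinish q"
    using assms(2) unfolding homotopic_paths by metis
  show ?thesis
    unfolding homotopic_paths
    by (intro exI[of _ "\<lambda>x. block_diag (h x) (k x)"] conjI continuous_on_block_diag h(1) k(1))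
      (use h k in \<open>auto simp: pathstart_def pathfinish_def Pi_iff intro!: block_diag_in_GL\<close>)
qed

section \<open>Products of manifolds with corners\<close>

lemma second_countable_prod_topology:
  assumes "second_countable X" "second_countable Y"
  shows "second_countable (prod_topology X Y)"
proof -
  obtain A B where A: "countable A" "\<forall>V\<in>A. openin X V"
      "\<forall>U x. openin X U \<and> x \<in> U \<longrightarrow> (\<exists>V\<in>A. x \<in> V \<and> V \<subseteq> U)"
    and B: "countable B" "\<forall>V\<in>B. openin Y V"
      "\<forall>U x. openin Y U \<and> x \<in> U \<longrightarrow> (\<exists>V\<in>B. x \<in> V \<and> V \<subseteq> U)"
    using assms unfolding second_countable_def by metis
  let ?C = "(\<lambda>(V, W). V \<times> W) ` (A \<times> B)"
  have "\<exists>V\<in>?C. p \<in> V \<and> V \<subseteq> U" if U: "openin (prod_topology X Y) U" and p: "p \<in> U" for U p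
  proof -
    obtain x y where [simp]: "p = (x, y)" by force
    obtain V W where "openin X V" "openin Y W" "x \<in> V" "y \<in> W" "V \<times> W \<subseteq> U"
      using U p unfolding openin_prod_topology_alt \<open>p = (x, y)\<close> by metis
    moreover then obtain V' W' where "V' \<in> A" "x \<in> V'" "V' \<subseteq> V" "W' \<in> B" "y \<in> W'" "W' \<subseteq> W"
      using A(3) B(3) by metis
    ultimately show ?thesis
      by (intro bexI[of _ "V' \<times> W'"]) auto
  qed
  moreover have "countable ?C" "\<forall>V\<in>?C. openin (prod_topology X Y) V"
    using A B by (auto simp: openin_prod_Times_iff)
  ultimately show ?thesis
    unfolding second_countable_def by blast
qed

lemma homeomorphic_map_map_prod:
  assumes "homeomorphic_map X X' f" "homeomorphic_map Y Y' g"
  shows "homeomorphic_map (prod_topology X Y) (prod_topology X' Y') (map_prod f g)"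
proof -
  obtain f' g' where "homeomorphic_maps X X' f f'" "homeomorphic_maps Y Y' g g'"
    using assms by (auto simp: homeomorphic_map_maps)
  then have "homeomorphic_maps (prod_topology X Y) (prod_topology X' Y')
      (\<lambda>(x, y). (f x, g y)) (\<lambda>(x, y). (f' x, g' y))"
    by (simp add: homeomorphic_maps_prod)
  then show ?thesis
    by (auto simp: homeomorphic_map_maps map_prod_def)
qed

lemma embedding_map_map_prod:
  assumes "embedding_map X X' f" "embedding_map Y Y' g"
  shows "embedding_map (prod_topology X Y) (prod_topology X' Y') (map_prod f g)"
  using homeomorphic_map_map_prod[OF assms[unfolded embedding_map_def]]
  by (simp add: embedding_map_def subtopology_Times[symmetric] map_prod_surj_on)

section \<open>Charts and local representatives of product maps\<close>

lemma manifold_with_corners_chart: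
  assumes "manifold_with_corners M" "c \<in> atlas M"
  shows "openin (mtop M) (fst c)" "openin (top_of_set orthant) (snd c ` fst c)"
    "homeomorphic_map (subtopology (mtop M) (fst c)) (top_of_set (snd c ` fst c)) (snd c)"
    "inj_on (snd c) (fst c)"
proof -
  show 1: "openin (mtop M) (fst c)" "openin (top_of_set orthant) (snd c ` fst c)"
    "homeomorphic_map (subtopology (mtop M) (fst c)) (top_of_set (snd c ` fst c)) (snd c)"
    using assms unfolding manifold_with_corners_def by (auto simp: case_prod_unfold)
  have "topspace (subtopology (mtop M) (fst c)) = fst c"
    using openin_subset[OF 1(1)] by (simp add: Int_absorb1)
  then show "inj_on (snd c) (fst c)"
    using homeomorphic_imp_injective_map[OF 1(3)] by simp
qed

text \<open>Compatibility of charts is literally smoothness of the identity. Transition maps and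
  Jacobians of a product are thus the case \<open>f = g = id\<close> of the statements on product
  maps.\<close>

lemma smooth_map_id:
  assumes "manifold_with_corners M"
  shows "smooth_map M M id"
  using assms by (auto simp: smooth_map_def manifold_with_corners_def)

text \<open>Supplies the openness on which uniqueness of derivatives depends. The part of the chart
  domain that \<open>f\<close> sends into \<open>fst d\<close> is open by continuity, and a chart is
  an open map onto a set open in the orthant.\<close>

lemma openin_local_rep_domain:
  assumes "manifold_with_corners M" "manifold_with_corners N" "continuous_map (mtop M) (mtop N) f"
    and "c \<in> atlas M" "d \<in> atlas N"
  shows "openin (top_of_set orthant) (snd c ` (fst c \<inter> f -` fst d))"
proof -
  note c = manifold_with_corners_chart[OF assms(1,4)]
  have "openin (mtop M) {x \<in> points M. f x \<in> fst d}"
    by (rule openin_continuous_map_preimage[OF assms(3) manifold_with_corners_chart(1)[OF assms(2,5)]])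
  then have "openin (mtop M) (fst c \<inter> {x \<in> points M. f x \<in> fst d})"
    using c(1) by (rule openin_Int[rotated])
  moreover have "fst c \<inter> {x \<in> points M. f x \<in> fst d} = fst c \<inter> f -` fst d"
    using openin_subset[OF c(1)] by auto
  ultimately have "openin (subtopology (mtop M) (fst c)) (fst c \<inter> f -` fst d)"
    using c(1) by (simp add: openin_open_subtopology)
  then have "openin (top_of_set (snd c ` fst c)) (snd c ` (fst c \<inter> f -` fst d))"
    using homeomorphic_imp_open_map[OF c(3)] by (simp add: open_map_def)
  then show ?thesis
    using c(2) by (rule openin_trans)
qed

lemma prod_chart_domain:
  "snd (prod_chart c c') ` (fst (prod_chart c c') \<inter> map_prod f g -` fst (prod_chart d d')) =
    snd c ` (fst c \<inter> f -` fst d) \<times> snd c' ` (fst c' \<inter> g -` fst d')"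
  by (force simp: prod_chart_def)

text \<open>\<open>inv_into\<close> is determined only on the image of an injective chart. Elsewhere
  its choice for the product chart has no reason to be the pair of the two choices, hence the
  condition on \<open>p\<close>.\<close>

lemma local_rep_map_prod:
  assumes "inj_on (snd c) (fst c)" "inj_on (snd c') (fst c')"
    and "p \<in> snd c ` fst c \<times> snd c' ` fst c'"
  shows "local_rep (prod_chart c c') (prod_chart d d') (map_prod f g) p =
    map_prod (local_rep c d f) (local_rep c' d' g) p"
proof -
  obtain x y where x: "x \<in> fst c" and y: "y \<in> fst c'" and p: "p = map_prod (snd c) (snd c') (x, y)"
    using assms(3) by auto
  have "inj_on (map_prod (snd c) (snd c')) (fst c \<times> fst c')"
    by (rule map_prod_inj_on[OF assms(1,2)])
  then have "inv_into (fst c \<times> fst c') (map_prod (snd c) (snd c')) p = (x, y)"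
    unfolding p using x y by (intro inv_into_f_f) auto
  then show ?thesis
    using x y assms(1,2) by (simp add: local_rep_def prod_chart_def p)
qed

lemma smooth_on_local_rep_map_prod:
  assumes "inj_on (snd c) (fst c)" "inj_on (snd c') (fst c')"
    and "smooth_on (snd c ` (fst c \<inter> f -` fst d)) (local_rep c d f)"
    and "smooth_on (snd c' ` (fst c' \<inter> g -` fst d')) (local_rep c' d' g)"
  shows "smooth_on (snd (prod_chart c c') ` (fst (prod_chart c c') \<inter> map_prod f g -` fst (prod_chart d d')))
    (local_rep (prod_chart c c') (prod_chart d d') (map_prod f g))"
  unfolding prod_chart_domain
  by (rule smooth_on_cong[OF smooth_on_map_prod[OF assms(3,4)]])
    (rule local_rep_map_prod[OF assms(1,2), symmetric], blast)

lemma points_prod_manifold: "points (M \<times>\<^sub>m N) = points M \<times> points N"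
  by (simp add: prod_manifold_def)

lemma atlas_prod_manifoldE:
  assumes "C \<in> atlas (M \<times>\<^sub>m N)"
  obtains c d where "C = prod_chart c d" "c \<in> atlas M" "d \<in> atlas N"
  using assms by (auto simp: prod_manifold_def)

lemma in_atlas_prod_manifold: "c \<in> atlas M \<Longrightarrow> d \<in> atlas N \<Longrightarrow> prod_chart c d \<in> atlas (M \<times>\<^sub>m N)"
  by (auto simp: prod_manifold_def simp del: split_paired_Ex)

lemma in_prod_chart_iff: "(x, y) \<in> fst (prod_chart c d) \<longleftrightarrow> x \<in> fst c \<and> y \<in> fst d"
  by (simp add: prod_chart_def)

lemma manifold_with_corners_prod:
  fixes M :: "('p, 'e::euclidean_space) manifold" and N :: "('q, 'f::euclidean_space) manifold"
  assumes "manifold_with_corners M" "manifold_with_corners N"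
  shows "manifold_with_corners (M \<times>\<^sub>m N)"
proof -
  note chartM = manifold_with_corners_chart[OF assms(1)]
  note chartN = manifold_with_corners_chart[OF assms(2)]
  have "Hausdorff_space (mtop (M \<times>\<^sub>m N))" "second_countable (mtop (M \<times>\<^sub>m N))"
    using assms by (simp_all add: manifold_with_corners_def prod_manifold_def
        Hausdorff_space_prod_topology second_countable_prod_topology)
  moreover have "\<Union> (fst ` atlas (M \<times>\<^sub>m N)) = points (M \<times>\<^sub>m N)"
  proof -
    have "\<Union> (fst ` atlas (M \<times>\<^sub>m N)) = \<Union> (fst ` atlas M) \<times> \<Union> (fst ` atlas N)"
    proof (intro equalityI subsetI)
      fix p assume "p \<in> \<Union> (fst ` atlas (M \<times>\<^sub>m N))"
      then obtain C where "C \<in> atlas (M \<times>\<^sub>m N)" and p: "p \<in> fst C"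
        by blast
      then obtain c d where "C = prod_chart c d" "c \<in> atlas M" "d \<in> atlas N"
        by (meson atlas_prod_manifoldE)
      then show "p \<in> \<Union> (fst ` atlas M) \<times> \<Union> (fst ` atlas N)"
        using p by (cases p) (force simp: in_prod_chart_iff)
    next
      fix p assume "p \<in> \<Union> (fst ` atlas M) \<times> \<Union> (fst ` atlas N)"
      then obtain x y c d where p: "p = (x, y)" "x \<in> fst c" "y \<in> fst d" and "c \<in> atlas M" "d \<in> atlas N"
        by blast
      then have "prod_chart c d \<in> atlas (M \<times>\<^sub>m N)" "p \<in> fst (prod_chart c d)"
        by (simp_all add: in_atlas_prod_manifold in_prod_chart_iff)
      then show "p \<in> \<Union> (fst ` atlas (M \<times>\<^sub>m N))"
        by blast
    qed
    then show ?thesis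
      using assms by (simp add: manifold_with_corners_def points_prod_manifold)
  qed
  moreover have "openin (mtop (M \<times>\<^sub>m N)) (fst C) \<and>
      openin (top_of_set orthant) (snd C ` fst C) \<and>
      homeomorphic_map (subtopology (mtop (M \<times>\<^sub>m N)) (fst C)) (top_of_set (snd C ` fst C)) (snd C)"
    if C: "C \<in> atlas (M \<times>\<^sub>m N)" for C
  proof -
    obtain c d where [simp]: "C = prod_chart c d" and cd: "c \<in> atlas M" "d \<in> atlas N"
      using C by (rule atlas_prod_manifoldE)
    have im: "snd C ` fst C = snd c ` fst c \<times> snd d ` fst d"
      by (force simp: prod_chart_def)
    have "openin (top_of_set orthant) (snd C ` fst C)"
      unfolding im orthant_Times using chartM(2)[OF cd(1)] chartN(2)[OF cd(2)]
      by (simp add: openin_prod_Times_iff flip: prod_topology_subtopology_eu)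
    moreover have "openin (mtop (M \<times>\<^sub>m N)) (fst C)"
      using chartM(1)[OF cd(1)] chartN(1)[OF cd(2)]
      by (simp add: prod_manifold_def prod_chart_def openin_prod_Times_iff)
    moreover have "homeomorphic_map (subtopology (mtop (M \<times>\<^sub>m N)) (fst C)) (top_of_set (snd C ` fst C)) (snd C)"
      using homeomorphic_map_map_prod[OF chartM(3)[OF cd(1)] chartN(3)[OF cd(2)]]
      unfolding im by (simp add: prod_manifold_def prod_chart_def subtopology_Times)
    ultimately show ?thesis by blast
  qed
  moreover have "smooth_on (snd C ` (fst C \<inter> fst D)) (local_rep C D id)"
    if C: "C \<in> atlas (M \<times>\<^sub>m N)" and D: "D \<in> atlas (M \<times>\<^sub>m N)" for C D
  proof -
    obtain c d where C': "C = prod_chart c d" and c: "c \<in> atlas M" and d: "d \<in> atlas N"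
      using C by (rule atlas_prod_manifoldE)
    obtain c' d' where D': "D = prod_chart c' d'" and c': "c' \<in> atlas M" and d': "d' \<in> atlas N"
      using D by (rule atlas_prod_manifoldE)
    have "smooth_on (snd c ` (fst c \<inter> id -` fst c')) (local_rep c c' id)"
      "smooth_on (snd d ` (fst d \<inter> id -` fst d')) (local_rep d d' id)"
      using smooth_map_id[OF assms(1)] smooth_map_id[OF assms(2)] c c' d d'
      unfolding smooth_map_def by blast+
    from smooth_on_local_rep_map_prod[OF chartM(4)[OF c] chartN(4)[OF d] this]
    show ?thesis
      by (simp add: C' D' map_prod.id)
  qed
  ultimately show ?thesis
    unfolding manifold_with_corners_def by (auto simp: case_prod_unfold)
qed

lemma smooth_map_map_prod:
  assumes "manifold_with_corners M" "manifold_with_corners M'" "smooth_map M N f" "smooth_map M' N' g"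
  shows "smooth_map (M \<times>\<^sub>m M') (N \<times>\<^sub>m N') (map_prod f g)"
  unfolding smooth_map_def
proof (intro conjI ballI)
  show "continuous_map (mtop (M \<times>\<^sub>m M')) (mtop (N \<times>\<^sub>m N')) (map_prod f g)"
    using assms by (simp add: smooth_map_def prod_manifold_def map_prod_def continuous_map_prod_top)
next
  fix C D assume C: "C \<in> atlas (M \<times>\<^sub>m M')" and D: "D \<in> atlas (N \<times>\<^sub>m N')"
  obtain c c' where C': "C = prod_chart c c'" and c: "c \<in> atlas M" "c' \<in> atlas M'"
    using C by (rule atlas_prod_manifoldE)
  obtain d d' where D': "D = prod_chart d d'" and d: "d \<in> atlas N" "d' \<in> atlas N'"
    using D by (rule atlas_prod_manifoldE)
  show "smooth_on (snd C ` (fst C \<inter> map_prod f g -` fst D)) (local_rep C D (map_prod f g))"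
    unfolding C' D'
    using manifold_with_corners_chart(4)[OF assms(1) c(1)] manifold_with_corners_chart(4)[OF assms(2) c(2)]
      assms(3,4) c d by (intro smooth_on_local_rep_map_prod) (simp_all add: smooth_map_def)
qed

section \<open>Differentials of product maps\<close>

lemma has_derivative_local_rep:
  fixes M :: "('p, 'e::euclidean_space) manifold" and N :: "('q, 'f::euclidean_space) manifold"
  assumes "smooth_map M N f" "c \<in> atlas M" "d \<in> atlas N" "x \<in> fst c \<inter> f -` fst d"
  shows "(local_rep c d f has_derivative mderiv c d f x)
    (at (snd c x) within snd c ` (fst c \<inter> f -` fst d))"
proof -
  have "local_rep c d f differentiable (at (snd c x) within snd c ` (fst c \<inter> f -` fst d))"
    by (rule smooth_on_imp_differentiable) (use assms in \<open>auto simp: smooth_map_def\<close>)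
  then have "(local_rep c d f has_derivative
      frechet_derivative (local_rep c d f) (at (snd c x) within snd c ` (fst c \<inter> f -` fst d)))
      (at (snd c x) within snd c ` (fst c \<inter> f -` fst d))"
    by (simp add: frechet_derivative_works[symmetric])
  \<comment> \<open>\<open>Blinfun\<close> is faithful only on bounded linear maps, and a derivative
    is one.\<close>
  then show ?thesis
    using has_derivative_bounded_linear by (fastforce simp: mderiv_def bounded_linear_Blinfun_apply)
qed

text \<open>Both sides are derivatives of the same local representative within the same product of
  domains, so uniqueness on relatively open subsets of the orthant identifies them.\<close>

lemma mderiv_map_prod:
  fixes M :: "('p, 'e::euclidean_space) manifold" and N :: "('q, 'f::euclidean_space) manifold"
    and M' :: "('p2, 'e2::euclidean_space) manifold" and N' :: "('q2, 'f2::euclidean_space) manifold"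
  assumes M: "manifold_with_corners M" "manifold_with_corners M'"
    and N: "manifold_with_corners N" "manifold_with_corners N'"
    and smooth: "smooth_map M N f" "smooth_map M' N' g"
    and c: "c \<in> atlas M" "c' \<in> atlas M'" and d: "d \<in> atlas N" "d' \<in> atlas N'"
    and x: "x \<in> fst c \<inter> f -` fst d" and y: "y \<in> fst c' \<inter> g -` fst d'"
  shows "blinfun_apply (mderiv (prod_chart c c') (prod_chart d d') (map_prod f g) (x, y)) =
    map_prod (mderiv c d f x) (mderiv c' d' g y)"
proof (rule frechet_derivative_unique_orthant)
  let ?h = "local_rep (prod_chart c c') (prod_chart d d') (map_prod f g)"
  let ?U = "snd c ` (fst c \<inter> f -` fst d)" and ?V = "snd c' ` (fst c' \<inter> g -` fst d')"
  have "openin (top_of_set orthant) ?U" "openin (top_of_set orthant) ?V"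
    using assms by (auto intro!: openin_local_rep_domain simp: smooth_map_def)
  then show "openin (top_of_set orthant) (?U \<times> ?V)"
    by (simp add: orthant_Times openin_prod_Times_iff flip: prod_topology_subtopology_eu)
  show xy: "(snd c x, snd c' y) \<in> ?U \<times> ?V"
    using x y by blast
  have "(?h has_derivative mderiv (prod_chart c c') (prod_chart d d') (map_prod f g) (x, y))
      (at (snd (prod_chart c c') (x, y)) within
        snd (prod_chart c c') ` (fst (prod_chart c c') \<inter> map_prod f g -` fst (prod_chart d d')))"
    by (rule has_derivative_local_rep[OF smooth_map_map_prod[OF M smooth]])
      (use c d x y in \<open>simp_all add: in_atlas_prod_manifold in_prod_chart_iff\<close>)
  then show "(?h has_derivative mderiv (prod_chart c c') (prod_chart d d') (map_prod f g) (x, y))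
      (at (snd c x, snd c' y) within ?U \<times> ?V)"
    unfolding prod_chart_domain by (simp add: prod_chart_def)
  have "(map_prod (local_rep c d f) (local_rep c' d' g) has_derivative
      map_prod (mderiv c d f x) (mderiv c' d' g y)) (at (snd c x, snd c' y) within ?U \<times> ?V)"
    by (rule has_derivative_map_prod[OF has_derivative_local_rep[OF smooth(1) c(1) d(1) x]
          has_derivative_local_rep[OF smooth(2) c(2) d(2) y]])
  moreover have "?h p = map_prod (local_rep c d f) (local_rep c' d' g) p" if "p \<in> ?U \<times> ?V" for p
  proof (rule local_rep_map_prod)
    show "inj_on (snd c) (fst c)" "inj_on (snd c') (fst c')"
      using M c by (simp_all add: manifold_with_corners_chart(4))
    show "p \<in> snd c ` fst c \<times> snd c' ` fst c'"
      using that by blast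
  qed
  ultimately show "(?h has_derivative map_prod (mderiv c d f x) (mderiv c' d' g y))
      (at (snd c x, snd c' y) within ?U \<times> ?V)"
    by (rule has_derivative_transform[OF xy, rotated])
qed

lemma jac_prod_chart:
  assumes M: "manifold_with_corners M" and N: "manifold_with_corners N"
    and "c \<in> atlas M" "c' \<in> atlas M" "d \<in> atlas N" "d' \<in> atlas N"
    and "x \<in> fst c \<inter> fst c'" "y \<in> fst d \<inter> fst d'"
  shows "jac (prod_chart c d) (prod_chart c' d') (x, y) = block_diag (jac c c' x) (jac d d' y)"
proof (rule blinfun_eqI)
  fix v
  have "blinfun_apply (mderiv (prod_chart c d) (prod_chart c' d') (map_prod id id) (x, y)) =
      map_prod (jac c c' x) (jac d d' y)"
    by (rule mderiv_map_prod[OF M N M N smooth_map_id[OF M] smooth_map_id[OF N]]) (use assms in auto)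
  then show "blinfun_apply (jac (prod_chart c d) (prod_chart c' d') (x, y)) v =
      blinfun_apply (block_diag (jac c c' x) (jac d d' y)) v"
    by (cases v) (simp add: map_prod.id)
qed

lemma smooth_embedding_map_prod:
  assumes M: "manifold_with_corners M" "manifold_with_corners M'"
    and N: "manifold_with_corners N" "manifold_with_corners N'"
    and f: "smooth_embedding M N f" and g: "smooth_embedding M' N' g"
  shows "smooth_embedding (M \<times>\<^sub>m M') (N \<times>\<^sub>m N') (map_prod f g)"
  unfolding smooth_embedding_def
proof (intro conjI ballI)
  have smooth: "smooth_map M N f" "smooth_map M' N' g"
    using f g by (auto simp: smooth_embedding_def)
  show "embedding_map (mtop (M \<times>\<^sub>m M')) (mtop (N \<times>\<^sub>m N')) (map_prod f g)"
    using f g by (simp add: smooth_embedding_def prod_manifold_def embedding_map_map_prod)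
  show "smooth_map (M \<times>\<^sub>m M') (N \<times>\<^sub>m N') (map_prod f g)"
    by (rule smooth_map_map_prod[OF M smooth])
  fix C D p assume C: "C \<in> atlas (M \<times>\<^sub>m M')" and D: "D \<in> atlas (N \<times>\<^sub>m N')"
    and p: "p \<in> fst C \<inter> map_prod f g -` fst D"
  obtain c c' where C': "C = prod_chart c c'" and c: "c \<in> atlas M" "c' \<in> atlas M'"
    using C by (rule atlas_prod_manifoldE)
  obtain d d' where D': "D = prod_chart d d'" and d: "d \<in> atlas N" "d' \<in> atlas N'"
    using D by (rule atlas_prod_manifoldE)
  obtain x y where p': "p = (x, y)" and xy: "x \<in> fst c \<inter> f -` fst d" "y \<in> fst c' \<inter> g -` fst d'"
    using p by (cases p) (auto simp: C' D' prod_chart_def)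
  have "inj (blinfun_apply (mderiv c d f x))" "inj (blinfun_apply (mderiv c' d' g y))"
    using f g c d xy by (auto simp: smooth_embedding_def)
  then show "inj (blinfun_apply (mderiv C D (map_prod f g) p))"
    unfolding C' D' p' mderiv_map_prod[OF M N smooth c d xy] by (rule prod.inj_map)
qed

lemma inj_blinfun_apply_GL:
  assumes "A \<in> GL"
  shows "inj (blinfun_apply A)"
proof -
  obtain B where "B o\<^sub>L A = id_blinfun"
    using assms by (auto simp: GL_def)
  then have "blinfun_apply B (blinfun_apply A v) = v" for v
    by (metis blinfun_apply_blinfun_compose blinfun_apply_id_blinfun id_apply)
  then show ?thesis
    by (rule inj_on_inverseI)
qed

text \<open>The immersion condition ranges over pairs of different charts, where the differential of
  the identity is a Jacobian. The orientation puts that Jacobian into \<open>GL_plus\<close>, so it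
  is invertible.\<close>

lemma smooth_embedding_id:
  assumes "manifold_with_corners M" "oriented M"
  shows "smooth_embedding M M id"
  unfolding smooth_embedding_def
proof (intro conjI ballI)
  show "embedding_map (mtop M) (mtop M) id"
    by (simp add: embedding_map_def)
  show "smooth_map M M id"
    by (rule smooth_map_id[OF assms(1)])
  show "inj (blinfun_apply (jac c d x))" if "c \<in> atlas M" "d \<in> atlas M" "x \<in> fst c \<inter> id -` fst d" for c d x
    using assms(2) that GL_plus_subset_GL by (intro inj_blinfun_apply_GL) (auto simp: oriented_def)
qed

section \<open>Depth, boundary and corners of a product\<close>

lemma depth_prod_chart: "depth (prod_chart c d) (x, y) = depth c x + depth d y"
  for c :: "('p, 'e::euclidean_space) chart" and d :: "('q, 'f::euclidean_space) chart"
proof -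
  let ?A = "{b \<in> Basis. snd c x \<bullet> b = 0}" and ?B = "{b \<in> Basis. snd d y \<bullet> b = 0}"
  have "{b \<in> Basis. snd (prod_chart c d) (x, y) \<bullet> b = 0} = (\<lambda>u. (u, 0)) ` ?A \<union> Pair 0 ` ?B"
    by (auto simp: prod_chart_def Basis_prod_def)
  \<comment> \<open>A common element would have both components zero, but basis vectors are
    nonzero.\<close>
  moreover have "(\<lambda>u. (u, 0)) ` ?A \<inter> Pair 0 ` ?B = {}"
    by (auto simp: nonzero_Basis)
  ultimately show ?thesis
    unfolding depth_def
    by (simp add: card_Un_disjoint card_image inj_on_def)
qed

lemma manifold_with_corners_codim_prod:
  assumes "manifold_with_corners_codim k M" "manifold_with_corners_codim l N"
  shows "manifold_with_corners_codim (k + l) (M \<times>\<^sub>m N)"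
  unfolding manifold_with_corners_codim_def
proof (intro conjI ballI)
  show "manifold_with_corners (M \<times>\<^sub>m N)"
    using assms by (simp add: manifold_with_corners_codim_def manifold_with_corners_prod)
  fix C p assume "C \<in> atlas (M \<times>\<^sub>m N)" "p \<in> fst C"
  moreover then obtain c d where C: "C = prod_chart c d" "c \<in> atlas M" "d \<in> atlas N"
    by (meson atlas_prod_manifoldE)
  moreover obtain x y where p: "p = (x, y)"
    by force
  ultimately have "depth c x \<le> k" "depth d y \<le> l"
    using assms by (simp_all add: manifold_with_corners_codim_def in_prod_chart_iff)
  then show "depth C p \<le> k + l"
    by (simp add: C p depth_prod_chart)
qed

lemma points_covered:
  assumes "manifold_with_corners M" "x \<in> points M"
  obtains c where "c \<in> atlas M" "x \<in> fst c"
  using assms unfolding manifold_with_corners_def by blast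

lemma boundary_subset_points:
  assumes "manifold_with_corners M"
  shows "boundary M \<subseteq> points M"
  using assms unfolding manifold_with_corners_def boundary_def by blast

lemma boundary_prod_manifold:
  assumes "manifold_with_corners M" "manifold_with_corners N"
  shows "boundary (M \<times>\<^sub>m N) = boundary M \<times> points N \<union> points M \<times> boundary N"
proof (intro equalityI subsetI)
  fix p assume "p \<in> boundary (M \<times>\<^sub>m N)"
  then obtain C where "C \<in> atlas (M \<times>\<^sub>m N)" "p \<in> fst C" "depth C p \<ge> 1"
    by (auto simp: boundary_def)
  moreover then obtain c d where C: "C = prod_chart c d" "c \<in> atlas M" "d \<in> atlas N"
    by (meson atlas_prod_manifoldE)
  moreover obtain x y where p: "p = (x, y)"
    by force
  ultimately have "x \<in> fst c" "y \<in> fst d" "depth c x \<ge> 1 \<or> depth d y \<ge> 1"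
    by (auto simp: in_prod_chart_iff depth_prod_chart)
  moreover have "fst c \<subseteq> points M" "fst d \<subseteq> points N"
    using assms C manifold_with_corners_chart(1) openin_subset by blast+
  ultimately show "p \<in> boundary M \<times> points N \<union> points M \<times> boundary N"
    using C unfolding p boundary_def by blast
next
  fix p assume p: "p \<in> boundary M \<times> points N \<union> points M \<times> boundary N"
  obtain x y where xy: "p = (x, y)"
    by force
  \<comment> \<open>The boundary point brings a chart of positive depth; around the other point any
    chart will do, since depths are nonnegative.\<close>
  consider "x \<in> boundary M" "y \<in> points N" | "x \<in> points M" "y \<in> boundary N"
    using p xy by auto
  then obtain c d where "c \<in> atlas M" "d \<in> atlas N" "x \<in> fst c" "y \<in> fst d" "depth c x + depth d y \<ge> 1"
  proof cases
    case 1
    moreover obtain d where "d \<in> atlas N" "y \<in> fst d"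
      using points_covered[OF assms(2) 1(2)] .
    ultimately show thesis
      using that[of _ d] by (auto simp: boundary_def simp del: split_paired_Ex split_paired_All)
  next
    case 2
    moreover obtain c where "c \<in> atlas M" "x \<in> fst c"
      using points_covered[OF assms(1) 2(1)] .
    ultimately show thesis
      using that[of c] by (auto simp: boundary_def simp del: split_paired_Ex split_paired_All)
  qed
  then show "p \<in> boundary (M \<times>\<^sub>m N)"
    unfolding xy boundary_def mem_Collect_eq
    by (intro bexI[of _ "prod_chart c d"])
      (simp_all add: in_prod_chart_iff depth_prod_chart in_atlas_prod_manifold)
qed

text \<open>The factors have depth at most 1, so a total depth of 2 forces depth exactly 1 in each
  of them.\<close>

lemma corners_2_prod_manifold:
  assumes "manifold_with_boundary M" "manifold_with_boundary N"
  shows "corners 2 (M \<times>\<^sub>m N) = boundary M \<times> boundary N"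
proof (intro equalityI subsetI)
  fix p assume "p \<in> corners 2 (M \<times>\<^sub>m N)"
  then obtain C where "C \<in> atlas (M \<times>\<^sub>m N)" "p \<in> fst C" "depth C p = 2"
    by (auto simp: corners_def)
  moreover then obtain c d where C: "C = prod_chart c d" "c \<in> atlas M" "d \<in> atlas N"
    by (meson atlas_prod_manifoldE)
  moreover obtain x y where p: "p = (x, y)"
    by force
  ultimately have xy: "x \<in> fst c" "y \<in> fst d" and "depth c x + depth d y = 2"
    by (auto simp: in_prod_chart_iff depth_prod_chart)
  moreover have "depth c x \<le> 1" "depth d y \<le> 1"
    using assms C xy by (auto simp: manifold_with_corners_codim_def)
  ultimately have "depth c x \<ge> 1" "depth d y \<ge> 1"
    by linarith+
  then show "p \<in> boundary M \<times> boundary N"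
    using C xy unfolding p boundary_def by blast
next
  fix p assume "p \<in> boundary M \<times> boundary N"
  then obtain x y c d where p: "p = (x, y)" and cd: "c \<in> atlas M" "d \<in> atlas N"
    and xy: "x \<in> fst c" "y \<in> fst d" and "depth c x \<ge> 1" "depth d y \<ge> 1"
    by (auto simp: boundary_def)
  moreover have "depth c x \<le> 1" "depth d y \<le> 1"
    using assms cd xy by (auto simp: manifold_with_corners_codim_def)
  ultimately have "depth (prod_chart c d) p = 2"
    by (simp add: depth_prod_chart)
  then show "p \<in> corners 2 (M \<times>\<^sub>m N)"
    unfolding corners_def mem_Collect_eq using cd xy
    by (intro bexI[of _ "prod_chart c d"]) (simp_all add: in_prod_chart_iff in_atlas_prod_manifold p)
qed

lemma closed_manifold_prod:
  assumes "closed_manifold M" "closed_manifold N"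
  shows "closed_manifold (M \<times>\<^sub>m N)"
  using assms manifold_with_corners_codim_prod[of 0 M 0 N]
  by (simp add: closed_manifold_def prod_manifold_def compact_space_prod_topology)

lemma oriented_prod:
  assumes "manifold_with_corners M" "manifold_with_corners N" "oriented M" "oriented N"
  shows "oriented (M \<times>\<^sub>m N)"
  unfolding oriented_def
proof (intro ballI)
  fix C D p assume C: "C \<in> atlas (M \<times>\<^sub>m N)" and D: "D \<in> atlas (M \<times>\<^sub>m N)" and p: "p \<in> fst C \<inter> fst D"
  obtain c d where C': "C = prod_chart c d" and c: "c \<in> atlas M" and d: "d \<in> atlas N"
    using C by (rule atlas_prod_manifoldE)
  obtain c' d' where D': "D = prod_chart c' d'" and c': "c' \<in> atlas M" and d': "d' \<in> atlas N"
    using D by (rule atlas_prod_manifoldE)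
  obtain x y where p': "p = (x, y)" and x: "x \<in> fst c \<inter> fst c'" and y: "y \<in> fst d \<inter> fst d'"
    using p by (cases p) (auto simp: C' D' in_prod_chart_iff)
  show "jac C D p \<in> GL_plus"
    unfolding C' D' p' jac_prod_chart[OF assms(1,2) c c' d d' x y]
    using assms(3,4) c c' d d' x y by (intro block_diag_in_GL_plus) (auto simp: oriented_def)
qed

section \<open>Products of Spin structures\<close>

text \<open>Needed because Jacobians and lifts of product charts are block sums only over the
  overlap \<open>V\<close> of the charts, not as functions on the whole type.\<close>

lemma continuous_lift_cong:
  assumes "continuous_lift T V A s" "\<And>x. x \<in> V \<Longrightarrow> A x = B x" "\<And>x. x \<in> V \<Longrightarrow> s x = r x"
  shows "continuous_lift T V B r"
  unfolding continuous_lift_def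
proof
  fix x assume "x \<in> V"
  then obtain U H where U: "openin T U" "x \<in> U" "U \<subseteq> V"
    and H: "continuous_map (prod_topology (subtopology T U) (top_of_set {0..1})) (top_of_set GL)
          (\<lambda>(y, t). H y t)"
      "\<forall>y\<in>U. H y 0 = id_blinfun \<and> H y 1 = A y \<and> homotopic_paths GL (H y) (s y)"
    using assms(1) unfolding continuous_lift_def by meson
  show "\<exists>U H. openin T U \<and> x \<in> U \<and> U \<subseteq> V \<and>
        continuous_map (prod_topology (subtopology T U) (top_of_set {0..1})) (top_of_set GL)
          (\<lambda>(y, t). H y t) \<and>
        (\<forall>y\<in>U. H y 0 = id_blinfun \<and> H y 1 = B y \<and> homotopic_paths GL (H y) (r y))"
    by (intro exI[of _ U] exI[of _ H] conjI U H(1)) (use H(2) U(3) assms(2,3) in \<open>auto simp: subset_eq\<close>)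
qed

lemma continuous_map_block_diag:
  assumes "continuous_map Z euclidean f" "continuous_map Z euclidean g"
  shows "continuous_map Z euclidean (\<lambda>z. block_diag (f z) (g z))"
proof -
  have "continuous_map Z (prod_topology euclidean euclidean) (\<lambda>z. (f z, g z))"
    unfolding continuous_map_paired using assms by blast
  then have fg: "continuous_map Z euclidean (\<lambda>z. (f z, g z))"
    by simp
  have "continuous_map euclidean euclidean (\<lambda>p. block_diag (fst p) (snd p))"
    by (auto intro!: continuous_intros)
  from continuous_map_compose[OF fg this] show ?thesis
    by (simp add: o_def)
qed

text \<open>The block sum of the two local families of paths, over the rectangle of their domains,
  is a local family for the block sum of the lifts.\<close>

lemma continuous_lift_block_diag:
  assumes "continuous_lift T V A s" "continuous_lift T' V' A' s'"
  shows "continuous_lift (prod_topology T T') (V \<times> V')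
    (\<lambda>p. block_diag (A (fst p)) (A' (snd p))) (\<lambda>p t. block_diag (s (fst p) t) (s' (snd p) t))"
  unfolding continuous_lift_def
proof
  fix p assume "p \<in> V \<times> V'"
  then obtain x y where p: "p = (x, y)" and "x \<in> V" "y \<in> V'"
    by auto
  obtain U H where U: "openin T U" "x \<in> U" "U \<subseteq> V"
    and H: "continuous_map (prod_topology (subtopology T U) (top_of_set {0..1})) (top_of_set GL)
          (\<lambda>(y, t). H y t)"
      "\<And>z. z \<in> U \<Longrightarrow> H z 0 = id_blinfun \<and> H z 1 = A z \<and> homotopic_paths GL (H z) (s z)"
    using assms(1) \<open>x \<in> V\<close> unfolding continuous_lift_def by meson
  obtain U' H' where U': "openin T' U'" "y \<in> U'" "U' \<subseteq> V'"
    and H': "continuous_map (prod_topology (subtopology T' U') (top_of_set {0..1})) (top_of_set GL)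
          (\<lambda>(y, t). H' y t)"
      "\<And>z. z \<in> U' \<Longrightarrow> H' z 0 = id_blinfun \<and> H' z 1 = A' z \<and> homotopic_paths GL (H' z) (s' z)"
    using assms(2) \<open>y \<in> V'\<close> unfolding continuous_lift_def by meson
  let ?Z = "prod_topology (subtopology (prod_topology T T') (U \<times> U')) (top_of_set {0..1::real})"
  let ?K = "\<lambda>p t. block_diag (H (fst p) t) (H' (snd p) t)"
  \<comment> \<open>Both families are run with the same path parameter: they are pulled back along
    the maps sending \<open>((x, y), t)\<close> to \<open>(x, t)\<close> and to
    \<open>(y, t)\<close>.\<close>
  have "continuous_map ?Z (prod_topology (subtopology T U) (top_of_set {0..1})) (\<lambda>q. (fst (fst q), snd q))"
    "continuous_map ?Z (prod_topology (subtopology T' U') (top_of_set {0..1})) (\<lambda>q. (snd (fst q), snd q))"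
    by (auto simp: continuous_map_paired subtopology_Times intro!: continuous_map_snd
        continuous_map_compose[OF continuous_map_fst continuous_map_fst, unfolded o_def]
        continuous_map_compose[OF continuous_map_fst continuous_map_snd, unfolded o_def])
  from continuous_map_compose[OF this(1) H(1)] continuous_map_compose[OF this(2) H'(1)]
  have c: "continuous_map ?Z (top_of_set GL) (\<lambda>q. H (fst (fst q)) (snd q))"
    "continuous_map ?Z (top_of_set GL) (\<lambda>q. H' (snd (fst q)) (snd q))"
    by (simp_all add: o_def)
  have "continuous_map ?Z (top_of_set GL) (\<lambda>q. ?K (fst q) (snd q))"
    using c by (auto simp: continuous_map_in_subtopology image_subset_iff Pi_iff
        intro!: continuous_map_block_diag block_diag_in_GL)
  then have "continuous_map ?Z (top_of_set GL) (\<lambda>(q, t). ?K q t)"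
    by (simp add: case_prod_unfold)
  moreover have "?K q 0 = id_blinfun \<and> ?K q 1 = block_diag (A (fst q)) (A' (snd q)) \<and>
      homotopic_paths GL (?K q) (\<lambda>t. block_diag (s (fst q) t) (s' (snd q) t))" if "q \<in> U \<times> U'" for q
    using H(2)[of "fst q"] H'(2)[of "snd q"] that
    by (auto simp: block_diag_id intro: homotopic_paths_block_diag)
  moreover have "openin (prod_topology T T') (U \<times> U')" "p \<in> U \<times> U'" "U \<times> U' \<subseteq> V \<times> V'"
    using U U' by (auto simp: p openin_prod_Times_iff)
  ultimately show "\<exists>W K. openin (prod_topology T T') W \<and> p \<in> W \<and> W \<subseteq> V \<times> V' \<and>
      continuous_map (prod_topology (subtopology (prod_topology T T') W) (top_of_set {0..1}))
        (top_of_set GL) (\<lambda>(q, t). K q t) \<and>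
      (\<forall>q\<in>W. K q 0 = id_blinfun \<and> K q 1 = block_diag (A (fst q)) (A' (snd q)) \<and>
        homotopic_paths GL (K q) (\<lambda>t. block_diag (s (fst q) t) (s' (snd q) t)))"
    by (intro exI[of _ "U \<times> U'"] exI[of _ ?K]) blast
qed

text \<open>The factors are recovered from a product chart only if both of its factors have nonempty
  domain; on charts with empty domain all conditions on lifts are vacuous.\<close>

definition chart_fst :: "('p \<times> 'q, 'e \<times> 'f) chart \<Rightarrow> ('p, 'e) chart" where
  "chart_fst C = (fst ` fst C, \<lambda>x. fst (snd C (x, undefined)))"

definition chart_snd :: "('p \<times> 'q, 'e \<times> 'f) chart \<Rightarrow> ('q, 'f) chart" where
  "chart_snd C = (snd ` fst C, \<lambda>y. snd (snd C (undefined, y)))"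

text \<open>The \<open>undefined\<close> in the second slot does no harm, since the first component
  of \<open>map_prod\<close> depends on the first argument alone.\<close>

lemma chart_fst_prod_chart: "fst d \<noteq> {} \<Longrightarrow> chart_fst (prod_chart c d) = c"
  by (cases c) (auto simp: chart_fst_def prod_chart_def)

lemma chart_snd_prod_chart: "fst c \<noteq> {} \<Longrightarrow> chart_snd (prod_chart c d) = d"
  by (cases d) (auto simp: chart_snd_def prod_chart_def)

text \<open>A lift takes arbitrary charts of the product as arguments, so the factor charts are
  extracted from \<open>C\<close> and \<open>D\<close>.\<close>

definition prod_spin_lift ::
    "('p, 'e::euclidean_space) spin_lift \<Rightarrow> ('q, 'f::euclidean_space) spin_lift \<Rightarrow> ('p \<times> 'q, 'e \<times> 'f) spin_lift" where
  "prod_spin_lift sM sN C D p t = block_diag (sM (chart_fst C) (chart_fst D) (fst p) t)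
     (sN (chart_snd C) (chart_snd D) (snd p) t)"

lemma prod_spin_lift_prod_chart:
  assumes "x \<in> fst c \<inter> fst c'" "y \<in> fst d \<inter> fst d'"
  shows "prod_spin_lift sM sN (prod_chart c d) (prod_chart c' d') (x, y) =
    (\<lambda>t. block_diag (sM c c' x t) (sN d d' y t))"
proof -
  \<comment> \<open>A point of the overlap lies in all four domains, so wherever the lift is
    evaluated the factor charts are recovered correctly.\<close>
  have "fst c \<noteq> {}" "fst c' \<noteq> {}" "fst d \<noteq> {}" "fst d' \<noteq> {}"
    using assms by auto
  then show ?thesis
    by (simp add: prod_spin_lift_def fun_eq_iff chart_fst_prod_chart chart_snd_prod_chart)
qed

text \<open>\<open>homotopic_paths\<close> is reflexive only on paths inside \<open>GL\<close>. That
  \<open>s c d x\<close> is one is implicit in \<open>continuous_lift\<close>, where it is homotopic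
  to a member of a local family; going there and back gives the claim. It serves to compare the
  product lift with the block sum, to which it is equal on overlaps.\<close>

lemma spin_structure_homotopic_refl:
  assumes "spin_structure M s" "c \<in> atlas M" "d \<in> atlas M" "x \<in> fst c \<inter> fst d"
  shows "homotopic_paths GL (s c d x) (s c d x)"
proof -
  have "continuous_lift (mtop M) (fst c \<inter> fst d) (jac c d) (s c d)"
    using assms by (simp add: spin_structure_def)
  then obtain p where "homotopic_paths GL p (s c d x)"
    using assms(4) unfolding continuous_lift_def by meson
  then show ?thesis
    using homotopic_paths_sym homotopic_paths_trans by blast
qed

lemma product_spin_structure_prod_spin_lift:
  fixes M :: "('p, 'e::euclidean_space) manifold" and N :: "('q, 'f::euclidean_space) manifold"
  assumes M: "manifold_with_corners M" "spin_structure M sM"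
    and N: "manifold_with_corners N" "spin_structure N sN"
  shows "product_spin_structure M sM N sN (prod_spin_lift sM sN)"
proof -
  let ?s = "prod_spin_lift sM sN"
  have "3 \<le> DIM('e \<times> 'f)"
    using M(2) by (simp add: spin_structure_def)
  moreover have "oriented (M \<times>\<^sub>m N)"
    using M N by (intro oriented_prod) (auto simp: spin_structure_def)
  moreover have "continuous_lift (mtop (M \<times>\<^sub>m N)) (fst C \<inter> fst D) (jac C D) (?s C D)"
    if C: "C \<in> atlas (M \<times>\<^sub>m N)" and D: "D \<in> atlas (M \<times>\<^sub>m N)" for C D
  proof -
    obtain c d where C': "C = prod_chart c d" and c: "c \<in> atlas M" and d: "d \<in> atlas N"
      using C by (rule atlas_prod_manifoldE)
    obtain c' d' where D': "D = prod_chart c' d'" and c': "c' \<in> atlas M" and d': "d' \<in> atlas N"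
      using D by (rule atlas_prod_manifoldE)
    have "continuous_lift (mtop M) (fst c \<inter> fst c') (jac c c') (sM c c')"
      "continuous_lift (mtop N) (fst d \<inter> fst d') (jac d d') (sN d d')"
      using M(2) N(2) c c' d d' by (auto simp: spin_structure_def)
    note lift = continuous_lift_block_diag[OF this]
    have CD: "fst C \<inter> fst D = (fst c \<inter> fst c') \<times> (fst d \<inter> fst d')"
      by (auto simp: C' D' prod_chart_def)
    have "continuous_lift (prod_topology (mtop M) (mtop N)) (fst C \<inter> fst D) (jac C D) (?s C D)"
      unfolding CD
    proof (rule continuous_lift_cong[OF lift])
      fix p assume p: "p \<in> (fst c \<inter> fst c') \<times> (fst d \<inter> fst d')"
      then obtain x y where xy: "p = (x, y)" "x \<in> fst c \<inter> fst c'" "y \<in> fst d \<inter> fst d'"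
        by blast
      show "block_diag (jac c c' (fst p)) (jac d d' (snd p)) = jac C D p"
        unfolding C' D' xy(1) jac_prod_chart[OF M(1) N(1) c c' d d' xy(2,3)] by simp
      show "(\<lambda>t. block_diag (sM c c' (fst p) t) (sN d d' (snd p) t)) = ?s C D p"
        unfolding C' D' xy(1) prod_spin_lift_prod_chart[OF xy(2,3)] by simp
    qed
    then show ?thesis
      by (simp add: prod_manifold_def)
  qed
  moreover have "homotopic_paths GL (\<lambda>t. ?s D E p t o\<^sub>L ?s C D p t) (?s C E p)"
    if C: "C \<in> atlas (M \<times>\<^sub>m N)" and D: "D \<in> atlas (M \<times>\<^sub>m N)" and E: "E \<in> atlas (M \<times>\<^sub>m N)"
      and p: "p \<in> fst C \<inter> fst D \<inter> fst E" for C D E p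
  proof -
    obtain c1 d1 where C': "C = prod_chart c1 d1" "c1 \<in> atlas M" "d1 \<in> atlas N"
      using C by (rule atlas_prod_manifoldE)
    obtain c2 d2 where D': "D = prod_chart c2 d2" "c2 \<in> atlas M" "d2 \<in> atlas N"
      using D by (rule atlas_prod_manifoldE)
    obtain c3 d3 where E': "E = prod_chart c3 d3" "c3 \<in> atlas M" "d3 \<in> atlas N"
      using E by (rule atlas_prod_manifoldE)
    obtain x y where p': "p = (x, y)" and x: "x \<in> fst c1 \<inter> fst c2 \<inter> fst c3"
      and y: "y \<in> fst d1 \<inter> fst d2 \<inter> fst d3"
      using p by (cases p) (auto simp: C' D' E' in_prod_chart_iff)
    have "homotopic_paths GL (\<lambda>t. sM c2 c3 x t o\<^sub>L sM c1 c2 x t) (sM c1 c3 x)"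
      using M(2) C'(2) D'(2) E'(2) x unfolding spin_structure_def by blast
    moreover have "homotopic_paths GL (\<lambda>t. sN d2 d3 y t o\<^sub>L sN d1 d2 y t) (sN d1 d3 y)"
      using N(2) C'(3) D'(3) E'(3) y unfolding spin_structure_def by blast
    \<comment> \<open>The cocycle condition of the product is the block sum of the two cocycle
      conditions, because block sums commute with composition
      (\<open>block_diag_compose\<close>).\<close>
    ultimately have "homotopic_paths GL
        (\<lambda>t. block_diag (sM c2 c3 x t o\<^sub>L sM c1 c2 x t) (sN d2 d3 y t o\<^sub>L sN d1 d2 y t))
        (\<lambda>t. block_diag (sM c1 c3 x t) (sN d1 d3 y t))"
      by (rule homotopic_paths_block_diag)
    then show ?thesis
      using x y unfolding C'(1) D'(1) E'(1) p'
      by (simp add: prod_spin_lift_prod_chart block_diag_compose)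
  qed
  ultimately have "spin_structure (M \<times>\<^sub>m N) ?s"
    by (simp add: spin_structure_def)
  moreover have "homotopic_paths GL (?s (prod_chart c d) (prod_chart c' d') (x, y))
      (\<lambda>t. block_diag (sM c c' x t) (sN d d' y t))"
    if "c \<in> atlas M" "c' \<in> atlas M" "d \<in> atlas N" "d' \<in> atlas N"
      "x \<in> fst c \<inter> fst c'" "y \<in> fst d \<inter> fst d'" for c c' d d' x y
    unfolding prod_spin_lift_prod_chart[OF that(5,6)] using M(2) N(2) that
    by (intro homotopic_paths_block_diag spin_structure_homotopic_refl)
  ultimately show ?thesis
    by (simp add: product_spin_structure_def)
qed

section \<open>Null bordisms and the corner\<close>

lemma empty_manifold_simps [simp]: "mtop empty_manifold = discrete_topology {}" "atlas empty_manifold = {}"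
  by (simp_all add: empty_manifold_def)

lemma boundary_empty_manifold [simp]: "boundary empty_manifold = {}"
  by (simp add: boundary_def)

lemma manifold_with_corners_codim_empty: "manifold_with_corners_codim k empty_manifold"
  by (simp add: manifold_with_corners_codim_def manifold_with_corners_def second_countable_discrete_topology)

lemma closed_manifold_empty: "closed_manifold empty_manifold"
  by (simp add: closed_manifold_def manifold_with_corners_codim_empty compact_space_discrete_topology)

lemma smooth_embedding_empty: "smooth_embedding empty_manifold empty_manifold f"
  by (simp add: smooth_embedding_def smooth_map_def embedding_map_def
      homeomorphic_eq_everything_map closed_map_def)

lemma spin_structure_empty:
  assumes "3 \<le> DIM('e::euclidean_space)"
  shows "spin_structure (empty_manifold :: ('p, 'e) manifold) s"
  using assms by (simp add: spin_structure_def oriented_def)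

lemma oriented_bordant_empty:
  "oriented_bordant (empty_manifold :: ('p, 'e::euclidean_space) manifold) (empty_manifold :: ('q, 'e) manifold)"
  unfolding oriented_bordant_def
  \<comment> \<open>The bordism is empty too. Its points are of type \<open>real\<close>, and any
    map, here the constant 0, embeds the empty set; the conditions on charts are vacuous.\<close>
  by (intro exI[of _ empty_manifold] exI[of _ "\<lambda>_. 0"])
    (simp add: manifold_with_corners_codim_empty compact_space_discrete_topology oriented_def
      oriented_boundary_embedding_def smooth_embedding_empty normal_field_def)

lemma spin_bordant_empty:
  assumes "3 \<le> DIM('e::euclidean_space)"
  shows "spin_bordant (empty_manifold :: ('p, 'e) manifold) s (empty_manifold :: ('q, 'e) manifold) s'"
  unfolding spin_bordant_def
  by (intro exI[of _ empty_manifold] exI[of _ "\<lambda>_. 0"] exI[of _ "\<lambda>_ _ _ _. id_blinfun"])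
    (use assms in \<open>simp add: manifold_with_corners_codim_empty compact_space_discrete_topology spin_structure_empty
      spin_boundary_embedding_def smooth_embedding_empty normal_field_def\<close>)

lemma spin_null_bordism:
  fixes M :: "('p, 'e::euclidean_space) manifold"
  assumes "spin_structure M sM" "spin_bordism_class M sM = spin_bordism_zero"
  obtains N :: "(real, real \<times> 'e) manifold" and sN j
  where "manifold_with_boundary N" "compact_space (mtop N)" "spin_structure N sN"
    "spin_boundary_embedding 1 M sM N sN j" "j ` points M = boundary N"
proof -
  \<comment> \<open>\<open>spin_structure\<close> includes this bound, so even the empty manifold
    satisfies it only in these dimensions; the Spin structure of \<open>M\<close> provides the
    bound.\<close>
  have "3 \<le> DIM('e)"
    using assms(1) by (simp add: spin_structure_def)
  then have "(empty_manifold, \<lambda>_ _ _ _. id_blinfun) \<in> (spin_bordism_zero :: ((real, 'e) manifold \<times> _) set)"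
    by (simp add: spin_bordism_zero_def spin_bordism_class_def closed_manifold_empty
        spin_structure_empty spin_bordant_empty)
  then have "spin_bordant M sM (empty_manifold :: (real, 'e) manifold) (\<lambda>_ _ _ _. id_blinfun)"
    unfolding assms(2)[symmetric] by (simp add: spin_bordism_class_def)
  then show ?thesis
    using that by (auto simp: spin_bordant_def)
qed

lemma oriented_null_bordism:
  fixes M :: "('p, 'e::euclidean_space) manifold"
  assumes "oriented_bordism_class M = oriented_bordism_zero"
  obtains N :: "(real, real \<times> 'e) manifold" and j
  where "manifold_with_boundary N" "compact_space (mtop N)" "oriented N"
    "oriented_boundary_embedding 1 M N j" "j ` points M = boundary N"
proof -
  have "empty_manifold \<in> (oriented_bordism_zero :: (real, 'e) manifold set)"
    by (simp add: oriented_bordism_zero_def oriented_bordism_class_def closed_manifold_empty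
        oriented_bordant_empty oriented_def)
  then have "oriented_bordant M (empty_manifold :: (real, 'e) manifold)"
    unfolding assms[symmetric] by (simp add: oriented_bordism_class_def)
  then show ?thesis
    using that by (auto simp: oriented_bordant_def)
qed

text \<open>Shared by the Spin and the oriented case: of a null bordism the corner sees only a
  smooth embedding of \<open>M\<close> onto the boundary of \<open>N\<close>, while compatibility
  with Spin structures or orientations is carried along outside.\<close>

lemma ten_dimensional_corner:
  fixes X :: "('x, real ^ 3) manifold" and S :: "('s, complex) manifold" and B :: "('b, real ^ 3) manifold"
    and M :: "('m, real ^ 8) manifold" and N :: "('n, real \<times> (real ^ 8)) manifold"
  assumes X: "manifold_with_boundary X" "oriented X"
    and S: "closed_manifold S" "parametrizes_boundary S X i" and B: "wraps B X w"
    and M: "closed_manifold M"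
    and N: "manifold_with_boundary N" "smooth_embedding M N j" "j ` points M = boundary N"
  shows "ten_dimensional_corner X S i B w M N j"
proof -
  have mfd: "manifold_with_corners X" "manifold_with_corners S" "manifold_with_corners M" "manifold_with_corners N"
    using X(1) S(1) M N(1) by (simp_all add: closed_manifold_def manifold_with_corners_codim_def)
  have i: "smooth_embedding S X i" "i ` points S = boundary X"
    using S(2) by (auto simp: parametrizes_boundary_def)
  have corners: "corners 2 (X \<times>\<^sub>m N) = boundary X \<times> boundary N"
    by (rule corners_2_prod_manifold[OF X(1) N(1)])
  show ?thesis
    unfolding ten_dimensional_corner_def
  proof (intro conjI)
    show "manifold_with_corners_codim 2 (X \<times>\<^sub>m N)"
      using manifold_with_corners_codim_prod[OF X(1) N(1)] by (simp add: numeral_2_eq_2)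
    show "mdim (X \<times>\<^sub>m N) = 12" "mdim (S \<times>\<^sub>m M) = 10"
      by (simp_all add: mdim_def)
    show "boundary (X \<times>\<^sub>m N) = boundary X \<times> points N \<union> points X \<times> boundary N"
      by (rule boundary_prod_manifold[OF mfd(1,4)])
    \<comment> \<open>The space-time face keeps all of \<open>X\<close>, so the identity of
      \<open>X\<close> is multiplied by the identification of \<open>M\<close> with the boundary of
      \<open>N\<close>.\<close>
    show "smooth_embedding (X \<times>\<^sub>m M) (X \<times>\<^sub>m N) (map_prod id j)"
      by (rule smooth_embedding_map_prod[OF mfd(1,3,1,4) smooth_embedding_id[OF mfd(1) X(2)] N(2)])
    show "map_prod id j ` points (X \<times>\<^sub>m M) = points X \<times> boundary N"
      by (simp add: points_prod_manifold map_prod_surj_on N(3))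
    show "corners 2 (X \<times>\<^sub>m N) = (boundary X \<times> points N) \<inter> (points X \<times> boundary N)"
      using boundary_subset_points[OF mfd(1)] boundary_subset_points[OF mfd(4)] by (auto simp: corners)
    show "closed_manifold (S \<times>\<^sub>m M)"
      by (rule closed_manifold_prod[OF S(1) M])
    show "smooth_embedding (S \<times>\<^sub>m M) (X \<times>\<^sub>m N) (map_prod i j)"
      by (rule smooth_embedding_map_prod[OF mfd(2,3,1,4) i(1) N(2)])
    show "map_prod i j ` points (S \<times>\<^sub>m M) = corners 2 (X \<times>\<^sub>m N)"
      unfolding points_prod_manifold corners by (rule map_prod_surj_on[OF i(2) N(3)])
    \<comment> \<open>The brane reaches the same corner as \<open>S\<close> because \<open>w\<close>
      maps its boundary onto that of \<open>X\<close>.\<close>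
    show "map_prod w j ` (boundary B \<times> points M) = corners 2 (X \<times>\<^sub>m N)"
      unfolding corners using B by (intro map_prod_surj_on N(3)) (simp add: wraps_def)
  qed
qed

theorem proposition4:
  fixes X :: "('x, real ^ 3) manifold" and sX :: "('x, real ^ 3) spin_lift"
    and Sigma :: "('s, complex) manifold" and g :: nat and i :: "'s \<Rightarrow> 'x"
    and B :: "('b, real ^ 3) manifold" and w :: "'b \<Rightarrow> 'x"
    and M :: "('m, real ^ 8) manifold"
  assumes "manifold_with_boundary X" and "spin_structure X sX"
    and "compact_riemann_surface g Sigma" and "parametrizes_boundary Sigma X i"
    and "manifold_with_boundary B" and "wraps B X w"
    and "closed_manifold M"
  shows
    "(\<forall>sM. spin_structure M sM \<and> spin_bordism_class M sM = spin_bordism_zero \<longrightarrow>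
        (\<exists>(N :: (real, real \<times> (real ^ 8)) manifold) sN j sZ.
           manifold_with_boundary N \<and> compact_space (mtop N) \<and> spin_structure N sN \<and>
           spin_boundary_embedding 1 M sM N sN j \<and> j ` points M = boundary N \<and>
           product_spin_structure X sX N sN sZ \<and>
           ten_dimensional_corner X Sigma i B w M N j)) \<and>
     (oriented M \<and> oriented_bordism_class M = oriented_bordism_zero \<longrightarrow>
        (\<exists>(N :: (real, real \<times> (real ^ 8)) manifold) j.
           manifold_with_boundary N \<and> compact_space (mtop N) \<and> oriented N \<and>
           oriented_boundary_embedding 1 M N j \<and> j ` points M = boundary N \<and>
           oriented (X \<times>\<^sub>m N) \<and>
           ten_dimensional_corner X Sigma i B w M N j))"
proof -
  \<comment> \<open>Taken from the Spin structure for both halves: it enters the embedding of the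
    space-time face and, in the second half, the orientation of the twelve-manifold.\<close>
  have "oriented X"
    using assms(2) by (simp add: spin_structure_def)
  have X: "manifold_with_corners X"
    using assms(1) by (simp add: manifold_with_corners_codim_def)
  have S: "closed_manifold Sigma"
    using assms(3) by (simp add: compact_riemann_surface_def)
  note corner = ten_dimensional_corner[OF assms(1) \<open>oriented X\<close> S assms(4,6,7)]
  show ?thesis
  proof (intro conjI allI impI; elim conjE)
    fix sM assume "spin_structure M sM" "spin_bordism_class M sM = spin_bordism_zero"
    then obtain N :: "(real, real \<times> (real ^ 8)) manifold" and sN j
      where N: "manifold_with_boundary N" "compact_space (mtop N)" "spin_structure N sN"
        "spin_boundary_embedding 1 M sM N sN j" "j ` points M = boundary N"
      by (rule spin_null_bordism)
    have "product_spin_structure X sX N sN (prod_spin_lift sX sN)"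
      using X assms(2) N(1,3)
      by (intro product_spin_structure_prod_spin_lift) (auto simp: manifold_with_corners_codim_def)
    moreover have "ten_dimensional_corner X Sigma i B w M N j"
      using N by (intro corner) (auto simp: spin_boundary_embedding_def)
    ultimately show "\<exists>(N :: (real, real \<times> (real ^ 8)) manifold) sN j sZ.
        manifold_with_boundary N \<and> compact_space (mtop N) \<and> spin_structure N sN \<and>
        spin_boundary_embedding 1 M sM N sN j \<and> j ` points M = boundary N \<and>
        product_spin_structure X sX N sN sZ \<and> ten_dimensional_corner X Sigma i B w M N j"
      using N by blast
  next
    assume "oriented_bordism_class M = oriented_bordism_zero"
    then obtain N :: "(real, real \<times> (real ^ 8)) manifold" and j
      where N: "manifold_with_boundary N" "compact_space (mtop N)" "oriented N"
        "oriented_boundary_embedding 1 M N j" "j ` points M = boundary N"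
      by (rule oriented_null_bordism)
    have "oriented (X \<times>\<^sub>m N)"
      using X \<open>oriented X\<close> N(1,3) by (intro oriented_prod) (auto simp: manifold_with_corners_codim_def)
    moreover have "ten_dimensional_corner X Sigma i B w M N j"
      using N by (intro corner) (auto simp: oriented_boundary_embedding_def)
    ultimately show "\<exists>(N :: (real, real \<times> (real ^ 8)) manifold) j.
        manifold_with_boundary N \<and> compact_space (mtop N) \<and> oriented N \<and>
        oriented_boundary_embedding 1 M N j \<and> j ` points M = boundary N \<and>
        oriented (X \<times>\<^sub>m N) \<and> ten_dimensional_corner X Sigma i B w M N j"
      using N by blast
  qed
qed

end
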